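(* Consider the polynomial regression model $y(x)=\theta^Tf(x)+\varepsilon(x)$ with $f(x)=(1,x,x^2,\dots,x^{m-1})^T$, $x\in[-1,1]$, and covariance kernel $$K(u,v)=\gamma+\frac{\beta}{|u-v|^\alpha},\qquad 0\le\alpha<1,\ \gamma\ge0,\ \beta>0.$$ Then the design with generalized arcsine density $$p_\alpha(x)=c_\alpha(1-x^2)^{(\alpha-1)/2},\qquad x\in[-1,1],$$ where $c_\alpha>0$ is the normalizing constant making $p_\alpha$ a probability density, is universally optimal.
   Context: A design is a (Borel) probability measure $\xi$ on $\mathcal X=[-1,1]$. For $\alpha>0$ the kernel is singular on the diagonal, $K(u,u)=+\infty$; for $\alpha=0$ it is constant. Set $$M(\xi)=\int f(u)f^T(u)\,\xi(du),\quad B(\xi,\xi)=\iint K(u,v)f(u)f^T(v)\,\xi(du)\,\xi(dv),$$ $$D(\xi)=M^{-1}(\xi)B(\xi,\xi)M^{-1}(\xi).$$ $\Xi$ is the set of designs $\xi$ for which $B(\xi,\xi)$ is well defined (the integrals exist and are finite) and $M(\xi)$ is invertible. A design $\xi^*\in\Xi$ is universally optimal if $D(\xi^* )\le D(\xi)$ in the Loewner ordering for every $\xi\in\Xi$. *)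

theory Defs
  imports
    "HOL-Probability.Probability"
    "Jordan_Normal_Form.Gauss_Jordan_Elimination"
begin

no_notation vec_nth (infixl "$" 90)

text \<open>
  Lebesgue integration of extended-real functions. An integral exists and is finite iff the
  integral of the absolute value is finite; the function is then finite almost everywhere, so
  replacing infinite values by 0 (which is what \<^const>\<open>real_of_ereal\<close> does) does not
  change its integral.
\<close>

definition ext_integrable :: "'a measure \<Rightarrow> ('a \<Rightarrow> ereal) \<Rightarrow> bool" where
  "ext_integrable M g \<longleftrightarrow>
     g \<in> borel_measurable M \<and> (\<integral>\<^sup>+ x. e2ennreal \<bar>g x\<bar> \<partial>M) < \<infinity>"

definition ext_integral :: "'a measure \<Rightarrow> ('a \<Rightarrow> ereal) \<Rightarrow> real" where
  "ext_integral M g = (LINT x|M. real_of_ereal (g x))"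

definition is_design :: "real measure \<Rightarrow> bool" where
  "is_design \<xi> \<longleftrightarrow> prob_space \<xi> \<and> sets \<xi> = sets (restrict_space borel {-1..1})"

text \<open>
  Below, \<open>f\<close> is the vector of the \<open>m\<close> regression functions and \<open>K\<close> the covariance kernel.
  Matrix and vector indices start at 0.
\<close>

definition M_mat :: "nat \<Rightarrow> (real \<Rightarrow> real vec) \<Rightarrow> real measure \<Rightarrow> real mat" where
  "M_mat m f \<xi> = Matrix.mat m m (\<lambda>(i, j). LINT u|\<xi>. f u $ i * f u $ j)"

definition B_integrand ::
    "(real \<Rightarrow> real vec) \<Rightarrow> (real \<Rightarrow> real \<Rightarrow> ereal) \<Rightarrow> nat \<Rightarrow> nat \<Rightarrow> real \<times> real \<Rightarrow> ereal" where
  "B_integrand f K i j = (\<lambda>(u, v). K u v * ereal (f u $ i * f v $ j))"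

definition B_well_defined ::
    "nat \<Rightarrow> (real \<Rightarrow> real vec) \<Rightarrow> (real \<Rightarrow> real \<Rightarrow> ereal) \<Rightarrow> real measure \<Rightarrow> bool" where
  "B_well_defined m f K \<xi> \<longleftrightarrow>
     (\<forall>i<m. \<forall>j<m. ext_integrable (\<xi> \<Otimes>\<^sub>M \<xi>) (B_integrand f K i j))"

definition B_mat ::
    "nat \<Rightarrow> (real \<Rightarrow> real vec) \<Rightarrow> (real \<Rightarrow> real \<Rightarrow> ereal) \<Rightarrow> real measure \<Rightarrow> real mat" where
  "B_mat m f K \<xi> = Matrix.mat m m (\<lambda>(i, j). ext_integral (\<xi> \<Otimes>\<^sub>M \<xi>) (B_integrand f K i j))"

definition D_mat ::
    "nat \<Rightarrow> (real \<Rightarrow> real vec) \<Rightarrow> (real \<Rightarrow> real \<Rightarrow> ereal) \<Rightarrow> real measure \<Rightarrow> real mat" where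
  "D_mat m f K \<xi> =
     the (mat_inverse (M_mat m f \<xi>)) * B_mat m f K \<xi> * the (mat_inverse (M_mat m f \<xi>))"

definition admissible_designs ::
    "nat \<Rightarrow> (real \<Rightarrow> real vec) \<Rightarrow> (real \<Rightarrow> real \<Rightarrow> ereal) \<Rightarrow> real measure set" where
  "admissible_designs m f K =
     {\<xi>. is_design \<xi> \<and> B_well_defined m f K \<xi> \<and> invertible_mat (M_mat m f \<xi>)}"

definition pos_semidef :: "nat \<Rightarrow> real mat \<Rightarrow> bool" where
  "pos_semidef m A \<longleftrightarrow>
     A \<in> carrier_mat m m \<and> transpose_mat A = A \<and>
     (\<forall>x \<in> carrier_vec m. 0 \<le> scalar_prod x (A *\<^sub>v x))"

definition loewner_le :: "nat \<Rightarrow> real mat \<Rightarrow> real mat \<Rightarrow> bool" where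
  "loewner_le m A B \<longleftrightarrow>
     A \<in> carrier_mat m m \<and> transpose_mat A = A \<and>
     B \<in> carrier_mat m m \<and> transpose_mat B = B \<and> pos_semidef m (B - A)"

definition universally_optimal ::
    "nat \<Rightarrow> (real \<Rightarrow> real vec) \<Rightarrow> (real \<Rightarrow> real \<Rightarrow> ereal) \<Rightarrow> real measure \<Rightarrow> bool" where
  "universally_optimal m f K \<xi>opt \<longleftrightarrow>
     \<xi>opt \<in> admissible_designs m f K \<and>
     (\<forall>\<xi> \<in> admissible_designs m f K. loewner_le m (D_mat m f K \<xi>opt) (D_mat m f K \<xi>))"

definition poly_regressors :: "nat \<Rightarrow> real \<Rightarrow> real vec" where
  "poly_regressors m x = Matrix.vec m (\<lambda>i. x ^ i)"

text \<open>
  The diagonal needs a separate clause because division by zero yields 0 and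
  \<open>0 powr 0 = 0\<close>: there the kernel is infinite for \<open>\<alpha> > 0\<close>, and
  equal to the constant \<open>\<gamma> + \<beta>\<close> for \<open>\<alpha> = 0\<close>.
\<close>

definition power_kernel :: "real \<Rightarrow> real \<Rightarrow> real \<Rightarrow> real \<Rightarrow> real \<Rightarrow> ereal" where
  "power_kernel \<gamma> \<beta> \<alpha> u v =
     (if u = v then (if \<alpha> = 0 then ereal (\<gamma> + \<beta>) else \<infinity>)
      else ereal (\<gamma> + \<beta> / \<bar>u - v\<bar> powr \<alpha>))"

definition arcsine_const :: "real \<Rightarrow> real" where
  "arcsine_const \<alpha> =
     1 / (LINT x|restrict_space lborel {-1..1}. (1 - x\<^sup>2) powr ((\<alpha> - 1) / 2))"

definition arcsine_density :: "real \<Rightarrow> real \<Rightarrow> real" where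
  "arcsine_density \<alpha> x = arcsine_const \<alpha> * (1 - x\<^sup>2) powr ((\<alpha> - 1) / 2)"

definition arcsine_design :: "real \<Rightarrow> real measure" where
  "arcsine_design \<alpha> =
     density (restrict_space lborel {-1..1}) (\<lambda>x. ennreal (arcsine_density \<alpha> x))"

end

theory Submission
  imports Defs "Jordan_Normal_Form.Determinant"
begin

text \<open>
  Let \<open>\<nu>\<close> be the arcsine design. The potential \<open>\<integral> \<bar>u - v\<bar>\<^sup>-\<^sup>\<alpha> p(v) \<nu>(dv)\<close> of a polynomial \<open>p\<close> is on
  \<open>(-1, 1)\<close> again a polynomial in \<open>u\<close>, of at most the same degree. Hence the mixed energy of
  \<open>g \<xi>\<close> and \<open>p \<nu>\<close> depends on \<open>g \<xi>\<close> only through its first \<open>m\<close> moments. For \<open>g = x\<^sup>T M\<^sup>-\<^sup>1(\<xi>) f\<close> these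
  moments are the entries of \<open>x\<close>, whatever the design \<open>\<xi>\<close>. So, with \<open>p = x\<^sup>T M\<^sup>-\<^sup>1(\<nu>) f\<close>, the mixed energy
  equals the energy of \<open>p \<nu>\<close>, which is \<open>x\<^sup>T D(\<nu>) x\<close>, and \<open>x\<^sup>T (D(\<xi>) - D(\<nu>)) x\<close> is the energy of the signed
  measure \<open>g \<xi> - p \<nu>\<close>. It is nonnegative because the Riesz kernel is of positive type.
\<close>

section \<open>Potentials of the arcsine weight\<close>

text \<open>The weight \<open>(1 - u\<^sup>2) powr ((\<alpha> - 1) / 2)\<close> is the equilibrium
  density of [-1, 1] for the Riesz kernel: its own potential is constant on (-1, 1). An explicit
  substitution onto the whole line proves this, and the exponent is what that substitution produces.
  Higher powers of the variable are then reached by integrating in the evaluation point. Positive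
  type is obtained without Fourier analysis: up to a constant the kernel is an integral over t of a
  function of (u, t) times the same function of (v, t), so an energy becomes the integral of a
  square. Two places resist: the diagonal, where the kernel is infinite for \<alpha> > 0, and the
  endpoints, where the potential formula is not established. For \<alpha> > 0 finite energy rules
  out atoms, which makes both negligible. For \<alpha> = 0 atoms are admissible, but the kernel is
  constant and nothing has to be excluded. The recurring alternative
  \<open>\<or> \<alpha> = 0\<close> carries both cases through the same lemmas.\<close>

lemma integrable_indicator_abs_powr:
  fixes \<alpha> :: real
  assumes "\<alpha> < 1"
  shows "integrable lborel (\<lambda>z::real. indicator {-1..1} z * \<bar>z\<bar> powr (-\<alpha>))"
proof -
  let ?f = "\<lambda>z::real. indicator {0..1} z * \<bar>z\<bar> powr (-\<alpha>)"
  have "(\<lambda>z::real. z powr (-\<alpha>)) integrable_on {0..1}"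
    using assms by (intro integrable_on_powr_from_0) auto
  then have "set_integrable lebesgue {0..1} (\<lambda>z::real. z powr (-\<alpha>))"
    by (intro nonnegative_absolutely_integrable_1) auto
  then have "integrable lebesgue ?f"
    unfolding set_integrable_def
    by (rule Bochner_Integration.integrable_cong[THEN iffD1, rotated 2])
       (auto simp: indicator_def)
  then have f: "integrable lborel ?f"
    by (subst (asm) integrable_completion) auto
  \<comment> \<open>The reflection covers [-1, 0]; the sum of both halves dominates the
    integrand.\<close>
  have "integrable lborel (\<lambda>z. ?f (0 + (-1) * z))"
    by (rule lborel_integrable_real_affine[OF f]) simp
  with f have "integrable lborel (\<lambda>z. ?f z + ?f (0 + (-1) * z))"
    by (rule Bochner_Integration.integrable_add)
  then show ?thesis
    by (rule Bochner_Integration.integrable_bound) (auto simp: indicator_def)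
qed

text \<open>The integral of this function will be the constant value of the potential. On [-1, 1]
  the denominator is at least 1 and \<open>\<alpha> < 1\<close> controls the singularity; outside,
  \<open>0 \<le> \<alpha>\<close> bounds the power by 1 and the denominator gives the decay.\<close>

lemma integrable_abs_powr_div_1_plus_square:
  fixes \<alpha> :: real
  assumes "0 \<le> \<alpha>" "\<alpha> < 1"
  shows "integrable lborel (\<lambda>z::real. \<bar>z\<bar> powr (-\<alpha>) / (1 + z\<^sup>2))"
proof -
  have "integrable lborel (\<lambda>z::real. inverse (1 + z\<^sup>2))"
    using integrable_inverse_1_plus_square by (simp add: set_integrable_def einterval_def)
  with integrable_indicator_abs_powr[OF assms(2)]
  have "integrable lborel (\<lambda>z::real. indicator {-1..1} z * \<bar>z\<bar> powr (-\<alpha>) + inverse (1 + z\<^sup>2))"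
    by (rule Bochner_Integration.integrable_add)
  then show ?thesis
  proof (rule Bochner_Integration.integrable_bound)
    show "AE z in lborel. norm (\<bar>z\<bar> powr (-\<alpha>) / (1 + z\<^sup>2))
        \<le> norm (indicator {-1..1} z * \<bar>z\<bar> powr (-\<alpha>) + inverse (1 + z\<^sup>2))"
    proof (intro AE_I2)
      fix z :: real
      have p: "0 < 1 + z\<^sup>2" by (simp add: add_pos_nonneg)
      show "norm (\<bar>z\<bar> powr (-\<alpha>) / (1 + z\<^sup>2))
        \<le> norm (indicator {-1..1} z * \<bar>z\<bar> powr (-\<alpha>) + inverse (1 + z\<^sup>2))"
      proof (cases "z \<in> {-1..1}")
        case True
        have "\<bar>z\<bar> powr (-\<alpha>) / (1 + z\<^sup>2) \<le> \<bar>z\<bar> powr (-\<alpha>) / 1"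
          using p by (intro divide_left_mono) auto
        with True p show ?thesis by (simp add: add_increasing2)
      next
        case False
        then have "1 \<le> \<bar>z\<bar> powr \<alpha>"
          using assms by (intro ge_one_powr_ge_zero) auto
        then have "\<bar>z\<bar> powr (-\<alpha>) \<le> 1"
          by (simp add: powr_minus inverse_le_1_iff)
        then have "\<bar>z\<bar> powr (-\<alpha>) / (1 + z\<^sup>2) \<le> inverse (1 + z\<^sup>2)"
          using p by (simp add: inverse_eq_divide divide_right_mono)
        with False p show ?thesis by simp
      qed
    qed
  qed auto
qed

text \<open>The function \<open>(z + v * w) / (w + v * z)\<close> with \<open>w = sqrt (1 - v\<^sup>2 + z\<^sup>2)\<close> inverts
  \<open>u \<mapsto> (u - v) / sqrt (1 - u\<^sup>2)\<close>.\<close>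

lemma arcsine_substitution:
  fixes v :: real
  assumes v: "-1 < v" "v < 1"
  defines "h \<equiv> \<lambda>u. (u - v) / sqrt (1 - u\<^sup>2)"
  shows "\<And>u. u \<in> {-1<..<1} \<Longrightarrow>
      (h has_field_derivative (1 - u * v) * (1 - u\<^sup>2) powr (-3/2)) (at u)"
    and "inj_on h {-1<..<1}"
    and "h ` {-1<..<1} = UNIV"
proof -
  have uv: "0 < 1 - u * v" if "u \<in> {-1<..<1}" for u
  proof -
    have "\<bar>u\<bar> * \<bar>v\<bar> < 1 * 1" using that v by (intro mult_strict_mono') auto
    then show ?thesis using abs_le_D1[of "u * v" "\<bar>u\<bar> * \<bar>v\<bar>"] by (simp add: abs_mult)
  qed
  have q: "0 < 1 - u\<^sup>2" if "u \<in> {-1<..<1}" for u :: real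
    using that by (simp add: abs_square_less_1 abs_less_iff)
  show der: "(h has_field_derivative (1 - u * v) * (1 - u\<^sup>2) powr (-3/2)) (at u)"
    if u: "u \<in> {-1<..<1}" for u
  proof -
    have s: "sqrt (1 - u\<^sup>2) = (1 - u\<^sup>2) powr (1/2)" using q[OF u] by (simp add: powr_half_sqrt)
    have "(h has_field_derivative
      (sqrt (1 - u\<^sup>2) - (u - v) * (- (2 * u) * (inverse (sqrt (1 - u\<^sup>2)) / 2))) / (sqrt (1 - u\<^sup>2) * sqrt (1 - u\<^sup>2))) (at u)"
      unfolding h_def using q[OF u]
      by (auto intro!: derivative_eq_intros simp: power2_eq_square)
    also have "(sqrt (1 - u\<^sup>2) - (u - v) * (- (2 * u) * (inverse (sqrt (1 - u\<^sup>2)) / 2))) / (sqrt (1 - u\<^sup>2) * sqrt (1 - u\<^sup>2))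
       = (1 - u * v) / (sqrt (1 - u\<^sup>2)) ^ 3"
    proof -
      define s where "s = sqrt (1 - u\<^sup>2)"
      have s0: "s \<noteq> 0" and s2: "s\<^sup>2 = 1 - u\<^sup>2" using q[OF u] by (auto simp: s_def)
      have "(s - (u - v) * (- (2 * u) * (inverse s / 2))) / (s * s) = (s\<^sup>2 + (u - v) * u) / s ^ 3"
        using s0 by (simp add: field_simps power2_eq_square power3_eq_cube)
      also have "s\<^sup>2 + (u - v) * u = 1 - u * v" unfolding s2 by (simp add: algebra_simps power2_eq_square)
      finally show ?thesis by (simp add: s_def)
    qed
    also have "\<dots> = (1 - u * v) * (1 - u\<^sup>2) powr (-3/2)"
    proof -
      have "sqrt (1 - u\<^sup>2) ^ 3 = (1 - u\<^sup>2) powr (3/2)"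
        unfolding s using q[OF u] by (subst powr_power) auto
      then show ?thesis by (simp add: powr_minus_divide)
    qed
    finally show ?thesis .
  qed
  show "inj_on h {-1<..<1}"
  proof (rule strict_mono_on_imp_inj_on, rule strict_mono_onI)
    fix r s :: real assume rs: "r \<in> {-1<..<1}" "s \<in> {-1<..<1}" "r < s"
    show "h r < h s"
    proof (rule DERIV_pos_imp_increasing[OF rs(3)])
      fix x assume x: "r \<le> x" "x \<le> s"
      with rs have "x \<in> {-1<..<1}" by auto
      from der[OF this] uv[OF this] q[OF this]
      show "\<exists>y. (h has_real_derivative y) (at x) \<and> 0 < y"
        by (intro exI[of _ "(1 - x * v) * (1 - x\<^sup>2) powr (-3/2)"]) simp
    qed
  qed
  have "z \<in> h ` {-1<..<1}" for z
  proof -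
    define w where "w = sqrt (1 - v\<^sup>2 + z\<^sup>2)"
    have v2: "0 < 1 - v\<^sup>2" using q[of v] v by simp
    then have w2: "w\<^sup>2 = 1 - v\<^sup>2 + z\<^sup>2" and w0: "0 < w"
      by (simp_all add: w_def add_pos_nonneg)
    have "\<bar>z\<bar> < w" unfolding w_def using v2 by (intro real_less_rsqrt) simp
    then have "\<bar>v\<bar> * \<bar>z\<bar> < 1 * w" using v w0 by (intro mult_strict_mono') auto
    then have L: "0 < w + v * z"
      using abs_ge_minus_self[of "v * z"] by (simp add: abs_mult)
    define u where "u = (z + v * w) / (w + v * z)"
    have 1: "u - v = (1 - v\<^sup>2) * z / (w + v * z)"
      unfolding u_def using L by (simp add: field_simps power2_eq_square)
    \<comment> \<open>Since \<open>w\<^sup>2 - z\<^sup>2 = 1 - v\<^sup>2\<close>, the numerator is a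
      perfect square, so the square root in \<open>h u\<close> can be extracted.\<close>
    have "1 - u\<^sup>2 = ((w + v * z)\<^sup>2 - (z + v * w)\<^sup>2) / (w + v * z)\<^sup>2"
      unfolding u_def using L by (simp add: power_divide diff_divide_distrib)
    also have "(w + v * z)\<^sup>2 - (z + v * w)\<^sup>2 = (w\<^sup>2 - z\<^sup>2) * (1 - v\<^sup>2)"
      by (simp add: power2_eq_square algebra_simps)
    also have "\<dots> = (1 - v\<^sup>2)\<^sup>2" unfolding w2 by (simp add: power2_eq_square)
    finally have 2: "1 - u\<^sup>2 = ((1 - v\<^sup>2) / (w + v * z))\<^sup>2" by (simp add: power_divide)
    then have 3: "sqrt (1 - u\<^sup>2) = (1 - v\<^sup>2) / (w + v * z)" using v2 L by simp
    have "0 < 1 - u\<^sup>2" unfolding 2 using v2 L by (simp add: zero_less_power2)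
    then have "u \<in> {-1<..<1}" by (simp add: abs_square_less_1 abs_less_iff)
    moreover have "h u = z" unfolding h_def 1 3 using v2 L by simp
    ultimately show ?thesis by blast
  qed
  then show "h ` {-1<..<1} = UNIV" by blast
qed

text \<open>With q = 1 - u^2 and L = 1 - u v, both \<open>1 + z\<^sup>2\<close> and the correction
  factor have the numerator L - v (u - v), over q and over L respectively. The numerator cancels,
  and the remaining 1 / L cancels against the derivative. The powers of q are -3/2 from the
  derivative, \<alpha> / 2 from \<open>\<bar>z\<bar> powr (-\<alpha>)\<close> and 1 from the
  denominator; their sum is the arcsine exponent.\<close>

lemma arcsine_substitution_integrand:
  fixes u v \<alpha> :: real
  assumes v: "-1 < v" "v < 1" and u: "-1 < u" "u < 1"
  defines "z \<equiv> (u - v) / sqrt (1 - u\<^sup>2)"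
  shows "\<bar>(1 - u * v) * (1 - u\<^sup>2) powr (-3/2)\<bar> *
      (\<bar>z\<bar> powr (-\<alpha>) / (1 + z\<^sup>2) * (1 - v * (z / sqrt (1 - v\<^sup>2 + z\<^sup>2))))
    = (1 - u\<^sup>2) powr ((\<alpha> - 1) / 2) * \<bar>u - v\<bar> powr (-\<alpha>)"
proof -
  define q where "q = 1 - u\<^sup>2"
  define L where "L = 1 - u * v"
  have q0: "0 < q" using u by (simp add: q_def abs_square_less_1)
  have "\<bar>u\<bar> * \<bar>v\<bar> < 1 * 1" using u v by (intro mult_strict_mono') auto
  then have L0: "0 < L" using abs_le_D1[of "u * v" "\<bar>u\<bar> * \<bar>v\<bar>"] by (simp add: abs_mult L_def)
  have z2: "z\<^sup>2 = (u - v)\<^sup>2 / q" using q0 by (simp add: z_def q_def power_divide)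
  have N: "1 + z\<^sup>2 = (L - v * (u - v)) / q"
    unfolding z2 using q0 by (simp add: field_simps) (simp add: q_def L_def algebra_simps power2_eq_square)
  have "1 - v\<^sup>2 + z\<^sup>2 = L\<^sup>2 / q"
    unfolding z2 using q0 by (simp add: field_simps) (simp add: q_def L_def algebra_simps power2_eq_square)
  then have w: "sqrt (1 - v\<^sup>2 + z\<^sup>2) = L / sqrt q" using L0 by (simp add: real_sqrt_divide)
  have "z / sqrt (1 - v\<^sup>2 + z\<^sup>2) = (u - v) / L"
    unfolding w using q0 by (simp add: z_def q_def[symmetric])
  then have M: "1 - v * (z / sqrt (1 - v\<^sup>2 + z\<^sup>2)) = (L - v * (u - v)) / L"
    using L0 by (simp add: diff_divide_distrib right_diff_distrib)
  have N0: "0 < L - v * (u - v)"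
  proof -
    have "0 < 1 + z\<^sup>2" by (simp add: add_pos_nonneg)
    then show ?thesis unfolding N using q0 by (simp add: zero_less_divide_iff)
  qed
  have zp: "\<bar>z\<bar> powr (-\<alpha>) = \<bar>u - v\<bar> powr (-\<alpha>) * q powr (\<alpha> / 2)"
  proof -
    have "\<bar>z\<bar> = \<bar>u - v\<bar> / q powr (1/2)"
      using q0 by (simp add: z_def q_def[symmetric] powr_half_sqrt)
    then have "\<bar>z\<bar> powr (-\<alpha>) = \<bar>u - v\<bar> powr (-\<alpha>) / q powr (- (\<alpha> / 2))"
      by (simp only: powr_divide abs_ge_zero powr_ge_zero powr_powr) simp
    then show ?thesis by (simp only: powr_minus divide_inverse inverse_inverse_eq)
  qed
  have "q powr (-3/2) * q powr (\<alpha> / 2) * q powr 1 = q powr (-3/2 + \<alpha> / 2 + 1)"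
    by (simp only: powr_add)
  also have "-3/2 + \<alpha> / 2 + 1 = (\<alpha> - 1) / 2" by (simp add: diff_divide_distrib)
  finally have "q powr (-3/2) * q powr (\<alpha> / 2) * q powr 1 = q powr ((\<alpha> - 1) / 2)" .
  then have qq: "q powr (-3/2) * q powr (\<alpha> / 2) * q = q powr ((\<alpha> - 1) / 2)" using q0 by simp
  have "L * X * (A * B / (D / q) * (D / L)) = (X * B * q) * A" if "D > 0" for X A B D
    using that L0 q0 by simp
  note this[OF N0, of "q powr (-3/2)" "\<bar>u - v\<bar> powr (-\<alpha>)" "q powr (\<alpha> / 2)"]
  moreover have "\<bar>L * q powr (-3/2)\<bar> = L * q powr (-3/2)" using L0 by (simp add: abs_mult)
  ultimately show ?thesis
    unfolding q_def[symmetric] L_def[symmetric] M unfolding N zp by (simp only: qq)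
qed

text \<open>After the substitution the dependence on \<open>v\<close> sits in a term that is odd in \<open>z\<close>.\<close>

lemma arcsine_potential_const:
  fixes v \<alpha> :: real
  assumes v: "-1 < v" "v < 1" and a: "0 \<le> \<alpha>" "\<alpha> < 1"
  shows "integrable lborel
      (\<lambda>u. indicator {-1<..<1} u * (1 - u\<^sup>2) powr ((\<alpha> - 1) / 2) * \<bar>u - v\<bar> powr (-\<alpha>))"
    and "(LINT u|lborel. indicator {-1<..<1} u * (1 - u\<^sup>2) powr ((\<alpha> - 1) / 2) * \<bar>u - v\<bar> powr (-\<alpha>))
      = (LINT z|lborel. \<bar>z\<bar> powr (-\<alpha>) / (1 + z\<^sup>2))"
proof -
  let ?H = "\<lambda>z::real. \<bar>z\<bar> powr (-\<alpha>) / (1 + z\<^sup>2)"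
  let ?s = "\<lambda>z::real. z / sqrt (1 - v\<^sup>2 + z\<^sup>2)"
  let ?F = "\<lambda>z. ?H z * (1 - v * ?s z)"
  let ?G = "\<lambda>u. (1 - u\<^sup>2) powr ((\<alpha> - 1) / 2) * \<bar>u - v\<bar> powr (-\<alpha>)"
  have H: "integrable lborel ?H" by (rule integrable_abs_powr_div_1_plus_square[OF a])
  have s1: "\<bar>?s z\<bar> \<le> 1" for z
  proof -
    have "\<bar>z\<bar> \<le> sqrt (1 - v\<^sup>2 + z\<^sup>2)" using v by (intro real_le_rsqrt) (simp add: abs_square_le_1)
    then have "\<bar>z\<bar> \<le> \<bar>sqrt (1 - v\<^sup>2 + z\<^sup>2)\<bar>" by linarith
    then show ?thesis by (simp add: abs_divide divide_le_eq_1)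
  qed
  have Hs: "integrable lborel (\<lambda>z. ?H z * ?s z)"
  proof (rule Bochner_Integration.integrable_bound[OF H])
    show "AE z in lborel. norm (?H z * ?s z) \<le> norm (?H z)"
      unfolding norm_mult using s1 by (intro AE_I2 mult_left_le) auto
  qed simp
  have "(LINT z|lborel. ?H z * ?s z) = (LINT z|lborel. ?H (0 + (-1) * z) * ?s (0 + (-1) * z))"
    using lborel_integral_real_affine[of "-1" "\<lambda>z. ?H z * ?s z" 0] by simp
  also have "\<dots> = - (LINT z|lborel. ?H z * ?s z)"
    by (simp flip: Bochner_Integration.integral_minus)
  finally have Hs0: "(LINT z|lborel. ?H z * ?s z) = 0" by simp
  have F: "integrable lborel ?F" and F_eq: "integral\<^sup>L lborel ?F = integral\<^sup>L lborel ?H"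
  proof -
    have eq: "?F = (\<lambda>z. ?H z - v * (?H z * ?s z))" by (simp add: algebra_simps)
    show "integrable lborel ?F" unfolding eq
      by (intro Bochner_Integration.integrable_diff integrable_mult_right H Hs)
    show "integral\<^sup>L lborel ?F = integral\<^sup>L lborel ?H" unfolding eq
      by (subst Bochner_Integration.integral_diff[OF H integrable_mult_right[OF Hs]])
        (simp only: integral_mult_right_zero Hs0 mult_zero_right diff_0_right)
  qed
  have FF: "?F absolutely_integrable_on UNIV" "integral UNIV ?F = integral\<^sup>L lborel ?H"
  proof -
    show "?F absolutely_integrable_on UNIV"
      using F by (simp add: set_integrable_def integrable_completion)
    show "integral UNIV ?F = integral\<^sup>L lborel ?H"
      using integral_lborel[OF F] F_eq by simp
  qed
  define R where "R = (\<lambda>u. \<bar>(1 - u * v) * (1 - u\<^sup>2) powr (-3/2)\<bar> * ?F ((u - v) / sqrt (1 - u\<^sup>2)))"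
  \<comment> \<open>The change of variables is read from the image, which is the whole line, back to
    the interval; it delivers integrability of the potential together with its value.\<close>
  have R: "R absolutely_integrable_on {-1<..<1} \<and> integral {-1<..<1} R = integral\<^sup>L lborel ?H"
    unfolding R_def
  proof (rule has_absolute_integral_change_of_variables_1'[where S = "{-1<..<1}"
        and g = "\<lambda>u. (u - v) / sqrt (1 - u\<^sup>2)" and g' = "\<lambda>u. (1 - u * v) * (1 - u\<^sup>2) powr (-3/2)"
        and f = ?F, THEN iffD2])
    show "((\<lambda>u. (u - v) / sqrt (1 - u\<^sup>2)) has_real_derivative (1 - u * v) * (1 - u\<^sup>2) powr (-3/2))
        (at u within {-1<..<1})" if "u \<in> {-1<..<1}" for u
      using arcsine_substitution(1)[OF v that] by (rule has_field_derivative_at_within)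
    show "inj_on (\<lambda>u. (u - v) / sqrt (1 - u\<^sup>2)) {-1<..<1}"
      by (rule arcsine_substitution(2)[OF v])
    show "?F absolutely_integrable_on (\<lambda>u. (u - v) / sqrt (1 - u\<^sup>2)) ` {-1<..<1} \<and>
        integral ((\<lambda>u. (u - v) / sqrt (1 - u\<^sup>2)) ` {-1<..<1}) ?F = integral\<^sup>L lborel ?H"
      unfolding arcsine_substitution(3)[OF v] using FF by simp
  qed simp
  have RG: "R u = ?G u" if "u \<in> {-1<..<1}" for u
    unfolding R_def using that by (intro arcsine_substitution_integrand[OF v]) auto
  have G: "?G absolutely_integrable_on {-1<..<1}"
    using R set_integrable_cong[of lebesgue lebesgue "{-1<..<1}" "{-1<..<1}" R ?G, OF refl refl RG] by simp
  have G_eq: "integral {-1<..<1} ?G = integral\<^sup>L lborel ?H"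
    using R Henstock_Kurzweil_Integration.integral_cong[of "{-1<..<1}" R ?G, OF RG] by simp
  show int: "integrable lborel
      (\<lambda>u. indicator {-1<..<1} u * (1 - u\<^sup>2) powr ((\<alpha> - 1) / 2) * \<bar>u - v\<bar> powr (-\<alpha>))"
    using G unfolding set_integrable_def by (subst (asm) integrable_completion) (auto simp: mult.assoc)
  then have si: "set_integrable lborel {-1<..<1} ?G" by (simp add: set_integrable_def mult.assoc)
  show "(LINT u|lborel. indicator {-1<..<1} u * (1 - u\<^sup>2) powr ((\<alpha> - 1) / 2) * \<bar>u - v\<bar> powr (-\<alpha>))
      = integral\<^sup>L lborel ?H"
    using set_borel_integral_eq_integral(2)[OF si] G_eq by (simp add: set_lebesgue_integral_def mult.assoc)
qed

text \<open>Unnormalized and extended by 0 to the whole line, so that plain Lebesgue integrals and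
  their affine substitutions apply; the open interval is the domain of the substitution
  above.\<close>

definition arcsine_weight :: "real \<Rightarrow> real \<Rightarrow> real" where
  "arcsine_weight \<alpha> u = indicator {-1<..<1} u * (1 - u\<^sup>2) powr ((\<alpha> - 1) / 2)"

lemma arcsine_weight_nonneg [simp]: "0 \<le> arcsine_weight \<alpha> u"
  by (simp add: arcsine_weight_def)

lemma borel_measurable_arcsine_weight [measurable]: "arcsine_weight \<alpha> \<in> borel_measurable borel"
  unfolding arcsine_weight_def[abs_def] by measurable

text \<open>On the support \<open>\<bar>u ^ k\<bar> \<le> 1\<close>, so the case of the constant 1
  dominates. The bound does not depend on \<open>v\<close>; this uniformity is what Fubini needs
  when \<open>v\<close> is integrated.\<close>

lemma integrable_arcsine_potential:
  fixes v \<alpha> :: real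
  assumes "0 \<le> \<alpha>" "\<alpha> < 1" "-1 < v" "v < 1"
  shows "integrable lborel (\<lambda>u. arcsine_weight \<alpha> u * \<bar>u ^ k\<bar> * \<bar>u - v\<bar> powr (-\<alpha>))"
    and "integrable lborel (\<lambda>u. arcsine_weight \<alpha> u * u ^ k * \<bar>u - v\<bar> powr (-\<alpha>))"
    and "(LINT u|lborel. arcsine_weight \<alpha> u * \<bar>u ^ k\<bar> * \<bar>u - v\<bar> powr (-\<alpha>))
      \<le> (LINT z|lborel. \<bar>z\<bar> powr (-\<alpha>) / (1 + z\<^sup>2))"
proof -
  have I: "integrable lborel (\<lambda>u. arcsine_weight \<alpha> u * \<bar>u - v\<bar> powr (-\<alpha>))"
    unfolding arcsine_weight_def using assms by (intro arcsine_potential_const(1))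
  have le: "arcsine_weight \<alpha> u * \<bar>u ^ k\<bar> \<le> arcsine_weight \<alpha> u" for u
    by (auto simp: arcsine_weight_def indicator_def power_abs intro!: mult_left_le power_le_one)
  show *: "integrable lborel (\<lambda>u. arcsine_weight \<alpha> u * \<bar>u ^ k\<bar> * \<bar>u - v\<bar> powr (-\<alpha>))"
    by (rule Bochner_Integration.integrable_bound[OF I])
       (auto simp: abs_mult intro!: AE_I2 mult_right_mono le)
  show "integrable lborel (\<lambda>u. arcsine_weight \<alpha> u * u ^ k * \<bar>u - v\<bar> powr (-\<alpha>))"
    by (rule Bochner_Integration.integrable_bound[OF *]) (auto simp: abs_mult)
  have "(LINT u|lborel. arcsine_weight \<alpha> u * \<bar>u ^ k\<bar> * \<bar>u - v\<bar> powr (-\<alpha>))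
      \<le> (LINT u|lborel. arcsine_weight \<alpha> u * \<bar>u - v\<bar> powr (-\<alpha>))"
    using * I by (intro integral_mono mult_right_mono le) auto
  also have "\<dots> = (LINT z|lborel. \<bar>z\<bar> powr (-\<alpha>) / (1 + z\<^sup>2))"
    unfolding arcsine_weight_def using assms by (intro arcsine_potential_const(2))
  finally show "(LINT u|lborel. arcsine_weight \<alpha> u * \<bar>u ^ k\<bar> * \<bar>u - v\<bar> powr (-\<alpha>))
      \<le> (LINT z|lborel. \<bar>z\<bar> powr (-\<alpha>) / (1 + z\<^sup>2))" .
qed

text \<open>The antiderivative in \<open>t\<close> brings out a factor u - t. Against
  \<open>u ^ k\<close> that factor produces the next power of \<open>u\<close>, which drives the
  recursion in the degree.\<close>

lemma integral_abs_diff_powr: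
  fixes u a b \<alpha> :: real
  assumes "\<alpha> < 1" "a \<le> b"
  shows "integrable lborel (\<lambda>t. indicator {a..b} t * \<bar>u - t\<bar> powr (-\<alpha>))"
    and "(1 - \<alpha>) * (LINT t|lborel. indicator {a..b} t * \<bar>u - t\<bar> powr (-\<alpha>))
      = (u - a) * \<bar>u - a\<bar> powr (-\<alpha>) - (u - b) * \<bar>u - b\<bar> powr (-\<alpha>)"
proof -
  \<comment> \<open>The antiderivative sgn(t - u) |t - u|^(1 - \<alpha>) / (1 - \<alpha>), written
    with \<open>max\<close> so that its continuity across \<open>t = u\<close> is immediate.
    Differentiability fails to be checked only at \<open>u\<close>, the exceptional point of the
    fundamental theorem below.\<close>
  define P where "P = (\<lambda>t. (max (t - u) 0 powr (1 - \<alpha>) - max (u - t) 0 powr (1 - \<alpha>)) / (1 - \<alpha>))"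
  have powr1: "x powr (1 - \<alpha>) = x * x powr (-\<alpha>)" if "0 \<le> x" for x :: real
    using that powr_add[of x 1 "-\<alpha>"] by (cases "x = 0") auto
  have P: "(1 - \<alpha>) * P t = - ((u - t) * \<bar>u - t\<bar> powr (-\<alpha>))" for t
  proof -
    have "(1 - \<alpha>) * P t = max (t - u) 0 powr (1 - \<alpha>) - max (u - t) 0 powr (1 - \<alpha>)"
      using assms by (simp add: P_def)
    then show ?thesis
      by (cases t u rule: linorder_cases) (auto simp: powr1 max_def algebra_simps)
  qed
  have "((\<lambda>t. \<bar>u - t\<bar> powr (-\<alpha>)) has_integral (P b - P a)) {a..b}"
  proof (rule fundamental_theorem_of_calculus_interior_strong[of "{u}"])
    show "continuous_on {a..b} P"
      unfolding P_def using assms by (intro continuous_intros continuous_on_powr') auto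
    show "(P has_vector_derivative \<bar>u - t\<bar> powr (-\<alpha>)) (at t)" if "t \<in> {a<..<b} - {u}" for t
    proof (cases "t < u")
      case True
      have "((\<lambda>t. (u - t) powr (1 - \<alpha>) / (1 - \<alpha>)) has_real_derivative - (\<bar>u - t\<bar> powr (-\<alpha>))) (at t)"
        using True assms by (auto intro!: derivative_eq_intros simp: divide_eq_eq)
      from DERIV_minus[OF this]
      have "((\<lambda>t. - ((u - t) powr (1 - \<alpha>) / (1 - \<alpha>))) has_real_derivative \<bar>u - t\<bar> powr (-\<alpha>)) (at t)"
        by simp
      then have "(P has_real_derivative \<bar>u - t\<bar> powr (-\<alpha>)) (at t)"
        by (rule has_field_derivative_transform_within_open[of _ _ _ "{..<u}"]) (use True in \<open>auto simp: P_def max_def\<close>)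
      then show ?thesis by (simp add: has_real_derivative_iff_has_vector_derivative)
    next
      case False
      with that have tu: "u < t" by auto
      have "((\<lambda>t. (t - u) powr (1 - \<alpha>) / (1 - \<alpha>)) has_real_derivative \<bar>u - t\<bar> powr (-\<alpha>)) (at t)"
        using tu assms by (auto intro!: derivative_eq_intros simp: divide_eq_eq)
      then have "(P has_real_derivative \<bar>u - t\<bar> powr (-\<alpha>)) (at t)"
        by (rule has_field_derivative_transform_within_open[of _ _ _ "{u<..}"]) (use tu in \<open>auto simp: P_def max_def\<close>)
      then show ?thesis by (simp add: has_real_derivative_iff_has_vector_derivative)
    qed
  qed (use assms in auto)
  then have hi: "(\<lambda>t. \<bar>u - t\<bar> powr (-\<alpha>)) integrable_on {a..b}"
    and ie: "integral {a..b} (\<lambda>t. \<bar>u - t\<bar> powr (-\<alpha>)) = P b - P a"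
    by (auto simp: integral_unique integrable_on_def)
  from hi have "(\<lambda>t. \<bar>u - t\<bar> powr (-\<alpha>)) absolutely_integrable_on {a..b}"
    by (intro nonnegative_absolutely_integrable_1) auto
  then show int: "integrable lborel (\<lambda>t. indicator {a..b} t * \<bar>u - t\<bar> powr (-\<alpha>))"
    unfolding set_integrable_def by (subst (asm) integrable_completion) auto
  then have si: "set_integrable lborel {a..b} (\<lambda>t. \<bar>u - t\<bar> powr (-\<alpha>))"
    by (simp add: set_integrable_def)
  have "(LINT t|lborel. indicator {a..b} t * \<bar>u - t\<bar> powr (-\<alpha>)) = P b - P a"
    using set_borel_integral_eq_integral(2)[OF si] ie by (simp add: set_lebesgue_integral_def)
  then show "(1 - \<alpha>) * (LINT t|lborel. indicator {a..b} t * \<bar>u - t\<bar> powr (-\<alpha>))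
      = (u - a) * \<bar>u - a\<bar> powr (-\<alpha>) - (u - b) * \<bar>u - b\<bar> powr (-\<alpha>)"
    by (simp add: right_diff_distrib P)
qed

section \<open>Potentials of monomials: recursion in the degree\<close>

definition arcsine_moment :: "real \<Rightarrow> nat \<Rightarrow> real \<Rightarrow> real" where
  "arcsine_moment \<alpha> k v = (LINT u|lborel. arcsine_weight \<alpha> u * u ^ k * \<bar>u - v\<bar> powr (-\<alpha>))"

lemma borel_measurable_arcsine_moment [measurable]: "arcsine_moment \<alpha> k \<in> borel_measurable borel"
  unfolding arcsine_moment_def[abs_def] by measurable

text \<open>The integrated form of \<open>(I\<^sub>k\<^sub>+\<^sub>1(v) - v I\<^sub>k(v))' = -(1 - \<alpha>) I\<^sub>k(v)\<close>, which needs no differentiability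
  of the moments \<open>I\<^sub>k\<close>. It raises the degree by one in the induction on \<open>k\<close>.\<close>

lemma arcsine_moment_diff:
  fixes a b \<alpha> :: real
  assumes \<alpha>: "0 \<le> \<alpha>" "\<alpha> < 1" and ab: "-1 < a" "a \<le> b" "b < 1"
  shows "(arcsine_moment \<alpha> (Suc k) a - a * arcsine_moment \<alpha> k a)
      - (arcsine_moment \<alpha> (Suc k) b - b * arcsine_moment \<alpha> k b)
      = (1 - \<alpha>) * (LINT t|lborel. indicator {a..b} t * arcsine_moment \<alpha> k t)"
proof -
  let ?W = "arcsine_weight \<alpha>" and ?C = "LINT z|lborel. \<bar>z\<bar> powr (-\<alpha>) / (1 + z\<^sup>2)"
  let ?f = "\<lambda>t u. indicator {a..b} t * (?W u * u ^ k * \<bar>u - t\<bar> powr (-\<alpha>))"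
  have int: "integrable (lborel \<Otimes>\<^sub>M lborel) (case_prod ?f)"
  proof (rule lborel_pair.Fubini_integrable)
    have "integrable lborel (\<lambda>t. indicator {a..b} t * ?C)"
      using ab by (intro integrable_mult_left integrable_real_indicator) auto
    then show "integrable lborel (\<lambda>t. LINT u|lborel. norm (case (t, u) of (t, u) \<Rightarrow> ?f t u))"
    proof (rule Bochner_Integration.integrable_bound)
      show "AE t in lborel. norm (LINT u|lborel. norm (case (t, u) of (t, u) \<Rightarrow> ?f t u)) \<le> norm (indicator {a..b} t * ?C)"
      proof (intro AE_I2)
        fix t
        show "norm (LINT u|lborel. norm (case (t, u) of (t, u) \<Rightarrow> ?f t u)) \<le> norm (indicator {a..b} t * ?C)"
        proof (cases "t \<in> {a..b}")
          case True
          with integrable_arcsine_potential(3)[OF \<alpha>, of t k] ab show ?thesis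
            by (auto simp: abs_mult)
        qed simp
      qed
    qed measurable
    show "AE t in lborel. integrable lborel (\<lambda>u. case (t, u) of (t, u) \<Rightarrow> ?f t u)"
      using integrable_arcsine_potential(2)[OF \<alpha>, of _ k] ab
      by (intro AE_I2) (auto simp: indicator_def)
  qed measurable
  have "(1 - \<alpha>) * (LINT t|lborel. indicator {a..b} t * arcsine_moment \<alpha> k t)
      = (1 - \<alpha>) * (LINT t|lborel. LINT u|lborel. ?f t u)"
    by (simp add: arcsine_moment_def)
  also have "\<dots> = (1 - \<alpha>) * (LINT u|lborel. LINT t|lborel. ?f t u)"
    using lborel_pair.Fubini_integral[OF int] by simp
  also have "\<dots> = (LINT u|lborel. ?W u * u ^ k * ((1 - \<alpha>) * (LINT t|lborel. indicator {a..b} t * \<bar>u - t\<bar> powr (-\<alpha>))))"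
    by (simp add: mult_ac flip: integral_mult_right_zero)
  \<comment> \<open>The factors u - a and u - b from the inner integral are multiplied out:
    \<open>u\<close> raises the power, \<open>a\<close> and \<open>b\<close> leave it.\<close>
  also have "\<dots> = (LINT u|lborel. (?W u * u ^ Suc k * \<bar>u - a\<bar> powr (-\<alpha>) - a * (?W u * u ^ k * \<bar>u - a\<bar> powr (-\<alpha>)))
      - (?W u * u ^ Suc k * \<bar>u - b\<bar> powr (-\<alpha>) - b * (?W u * u ^ k * \<bar>u - b\<bar> powr (-\<alpha>))))"
    unfolding integral_abs_diff_powr(2)[OF \<alpha>(2) ab(2)] by (simp add: algebra_simps)
  also have "\<dots> = (arcsine_moment \<alpha> (Suc k) a - a * arcsine_moment \<alpha> k a)
      - (arcsine_moment \<alpha> (Suc k) b - b * arcsine_moment \<alpha> k b)"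
  proof -
    note i = integrable_arcsine_potential(2)[OF \<alpha>]
    have va: "-1 < a" "a < 1" and vb: "-1 < b" "b < 1" using ab by auto
    show ?thesis
      unfolding arcsine_moment_def
      using i[OF va, of k] i[OF va, of "Suc k"] i[OF vb, of k] i[OF vb, of "Suc k"]
      by (simp only: Bochner_Integration.integral_diff Bochner_Integration.integrable_diff
          integrable_mult_right integral_mult_right_zero)
  qed
  finally show ?thesis by simp
qed

text \<open>By induction: the base is the constant potential. In the step, \<open>J\<close> is a
  constant minus a multiple of an antiderivative \<open>Q\<close> of the previous polynomial, hence
  of degree at most k + 1, and so is \<open>J v + v * arcsine_moment \<alpha> k v\<close>.\<close>

lemma arcsine_moment_polynomial:
  fixes \<alpha> :: real
  assumes \<alpha>: "0 \<le> \<alpha>" "\<alpha> < 1"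
  shows "\<exists>c. \<forall>v. -1 < v \<and> v < 1 \<longrightarrow> arcsine_moment \<alpha> k v = (\<Sum>j\<le>k. c j * v ^ j)"
proof (induction k)
  case 0
  show ?case
    using arcsine_potential_const(2)[OF _ _ \<alpha>]
    by (intro exI[of _ "\<lambda>_. LINT z|lborel. \<bar>z\<bar> powr (-\<alpha>) / (1 + z\<^sup>2)"])
       (simp add: arcsine_moment_def arcsine_weight_def)
next
  case (Suc k)
  then obtain c where c: "\<And>v. -1 < v \<Longrightarrow> v < 1 \<Longrightarrow> arcsine_moment \<alpha> k v = (\<Sum>j\<le>k. c j * v ^ j)"
    by blast
  define Q where "Q v = (\<Sum>j\<le>k. c j * (v ^ Suc j / Suc j))" for v :: real
  define J where "J v = arcsine_moment \<alpha> (Suc k) v - v * arcsine_moment \<alpha> k v" for v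
  have *: "J a - J b = (1 - \<alpha>) * (Q b - Q a)" if ab: "-1 < a" "a \<le> b" "b < 1" for a b
  proof -
    have "(LINT t|lborel. indicator {a..b} t * arcsine_moment \<alpha> k t)
       = (LINT t|lborel. (\<Sum>j\<le>k. c j * (t ^ j * indicator {a..b} t)))"
      using ab by (intro Bochner_Integration.integral_cong) (auto simp: c indicator_def)
    also have "\<dots> = (\<Sum>j\<le>k. LINT t|lborel. c j * (t ^ j * indicator {a..b} t))"
      using borel_integrable_atLeastAtMost[of a b "\<lambda>t. t ^ _"]
      by (intro Bochner_Integration.integral_sum integrable_mult_right) (auto simp: mult_ac indicator_def if_distrib cong: if_cong)
    also have "\<dots> = (\<Sum>j\<le>k. c j * ((b ^ Suc j - a ^ Suc j) / Suc j))"
      using integral_power[OF ab(2)] by simp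
    also have "\<dots> = Q b - Q a"
      unfolding Q_def sum_subtractf[symmetric] by (intro sum.cong) (auto simp: diff_divide_distrib right_diff_distrib)
    finally show ?thesis
      using arcsine_moment_diff[OF \<alpha> ab, of k] by (simp add: J_def)
  qed
  \<comment> \<open>Comparison with the point 0, where \<open>Q\<close> vanishes; the sign of
    \<open>v\<close> decides which of the two is the left end of the interval.\<close>
  have J: "J v = J 0 - (1 - \<alpha>) * Q v" if "-1 < v" "v < 1" for v
  proof -
    have "Q 0 = 0" by (simp add: Q_def)
    then show ?thesis using *[of 0 v] *[of v 0] that by (cases "0 \<le> v") auto
  qed
  \<comment> \<open>The coefficient of degree i + 1 collects \<open>c i\<close> from the shift by
    \<open>v\<close> and the rest from \<open>Q\<close>; degree 0 receives only
    \<open>J 0\<close>.\<close>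
  have "arcsine_moment \<alpha> (Suc k) v
      = (\<Sum>j\<le>Suc k. (case j of 0 \<Rightarrow> J 0 | Suc i \<Rightarrow> c i - (1 - \<alpha>) * (c i / Suc i)) * v ^ j)"
    if v: "-1 < v" "v < 1" for v
  proof -
    have "arcsine_moment \<alpha> (Suc k) v = J 0 - (1 - \<alpha>) * Q v + v * (\<Sum>j\<le>k. c j * v ^ j)"
      using J[OF v] c[OF v] by (simp add: J_def)
    also have "\<dots> = J 0 + (\<Sum>j\<le>k. v * (c j * v ^ j) - (1 - \<alpha>) * (c j * (v ^ Suc j / Suc j)))"
      by (simp add: Q_def sum_subtractf sum_distrib_left)
    also have "\<dots> = J 0 + (\<Sum>j\<le>k. (c j - (1 - \<alpha>) * (c j / Suc j)) * v ^ Suc j)"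
      by (intro arg_cong2[of _ _ _ _ "(+)"] sum.cong refl) (simp add: left_diff_distrib)
    also have "\<dots> = (\<Sum>j\<le>Suc k. (case j of 0 \<Rightarrow> J 0 | Suc i \<Rightarrow> c i - (1 - \<alpha>) * (c i / Suc i)) * v ^ j)"
      by (subst sum.atMost_Suc_shift) simp
    finally show ?thesis .
  qed
  then show ?case by blast
qed

section \<open>Positivity of Riesz energies\<close>

text \<open>Real-valued: for \<open>\<alpha> > 0\<close> the diagonal value is 0 by the convention
  for \<open>0 powr\<close>, not infinity, so statements about it come with an off-diagonal
  condition. The case \<open>\<alpha> = 0\<close> is separate because
  \<open>0 powr 0 = 0\<close>.\<close>

definition riesz_kernel :: "real \<Rightarrow> real \<Rightarrow> real \<Rightarrow> real" where
  "riesz_kernel \<alpha> u v = (if \<alpha> = 0 then 1 else \<bar>u - v\<bar> powr (-\<alpha>))"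

text \<open>A Beta integral, with arguments (1 - \<alpha>) / 2 and \<alpha>; only its finiteness and
  positivity matter. Near 0 the exponent (1 + \<alpha>) / 2 is below 1, at infinity 1 + \<alpha>
  exceeds 1. The latter needs \<open>0 < \<alpha>\<close>. On (0, 1] the integrand is at least
  \<open>2 powr (-(1 + \<alpha>) / 2)\<close>.\<close>

lemma riesz_const:
  fixes \<alpha> :: real
  assumes "0 < \<alpha>" "\<alpha> < 1"
  defines "f \<equiv> \<lambda>r::real. indicator {0<..} r * (r powr (-(1 + \<alpha>) / 2) * (1 + r) powr (-(1 + \<alpha>) / 2))"
  shows "integrable lborel f" and "0 < integral\<^sup>L lborel f"
proof -
  let ?a = "(1 + \<alpha>) / 2"
  have "((\<lambda>x. x powr (-(1 + \<alpha>))) has_integral -(1 powr (-(1 + \<alpha>) + 1)) / (-(1 + \<alpha>) + 1)) {1..}"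
    using assms by (intro has_integral_powr_to_inf) auto
  then have "(\<lambda>x::real. x powr (-(1 + \<alpha>))) absolutely_integrable_on {1..}"
    by (intro nonnegative_absolutely_integrable_1) (auto simp: integrable_on_def)
  then have 1: "integrable lborel (\<lambda>x::real. indicator {1..} x * x powr (-(1 + \<alpha>)))"
    unfolding set_integrable_def by (subst (asm) integrable_completion) auto
  have 2: "integrable lborel (\<lambda>x::real. indicator {-1..1} x * \<bar>x\<bar> powr (-?a))"
    using assms by (intro integrable_indicator_abs_powr) auto
  show int: "integrable lborel f"
  proof (rule Bochner_Integration.integrable_bound[OF Bochner_Integration.integrable_add[OF 1 2]])
    show "AE r in lborel. norm (f r) \<le> norm (indicator {1..} r * r powr (-(1 + \<alpha>)) + indicator {-1..1} r * \<bar>r\<bar> powr (-?a))"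
    proof (intro AE_I2)
      fix r :: real
      consider "r \<le> 0" | "0 < r" "r \<le> 1" | "1 < r" by linarith
      then show "norm (f r) \<le> norm (indicator {1..} r * r powr (-(1 + \<alpha>)) + indicator {-1..1} r * \<bar>r\<bar> powr (-?a))"
      proof cases
        case 2
        then have "(1 + r) powr (-(1 + \<alpha>) / 2) \<le> (1 + r) powr 0"
          using assms by (intro powr_mono) auto
        with 2 have "r powr (-(1 + \<alpha>) / 2) * (1 + r) powr (-(1 + \<alpha>) / 2) \<le> r powr (-(1 + \<alpha>) / 2)"
          by (intro mult_left_le) auto
        with 2 show ?thesis by (auto simp: f_def minus_divide_left add_increasing)
      next
        case 3
        then have "(1 + r) powr (-(1 + \<alpha>) / 2) \<le> r powr (-(1 + \<alpha>) / 2)"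
          using assms by (intro powr_mono2') auto
        then have "r powr (-(1 + \<alpha>) / 2) * (1 + r) powr (-(1 + \<alpha>) / 2) \<le> r powr (-(1 + \<alpha>) / 2) * r powr (-(1 + \<alpha>) / 2)"
          by (intro mult_left_mono) auto
        also have "\<dots> = r powr (-(1 + \<alpha>))"
          by (simp only: powr_add[symmetric] field_sum_of_halves)
        finally show ?thesis using 3 by (auto simp: f_def)
      qed (auto simp: f_def)
    qed
  qed (simp add: f_def)
  have "0 < 2 powr (-(1 + \<alpha>) / 2) * measure lborel {0<..1::real}" by simp
  also have "\<dots> = (LINT r|lborel. 2 powr (-(1 + \<alpha>) / 2) * indicator {0<..1::real} r)"
    by simp
  also have "\<dots> \<le> integral\<^sup>L lborel f"
  proof (intro integral_mono int integrable_mult_right integrable_real_indicator)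
    fix r :: real
    show "2 powr (-(1 + \<alpha>) / 2) * indicator {0<..1} r \<le> f r"
    proof (cases "r \<in> {0<..1}")
      case True
      have "1 * 2 powr (-(1 + \<alpha>) / 2) \<le> r powr (-(1 + \<alpha>) / 2) * (1 + r) powr (-(1 + \<alpha>) / 2)"
      proof (intro mult_mono)
        show "2 powr (-(1 + \<alpha>) / 2) \<le> (1 + r) powr (-(1 + \<alpha>) / 2)"
          using True assms by (intro powr_mono2') auto
        have "1 powr (-(1 + \<alpha>) / 2) \<le> r powr (-(1 + \<alpha>) / 2)"
          using True assms by (intro powr_mono2') auto
        then show "1 \<le> r powr (-(1 + \<alpha>) / 2)" by simp
      qed auto
      with True show ?thesis by (simp add: f_def)
    qed (auto simp: f_def)
  qed auto
  finally show "0 < integral\<^sup>L lborel f" .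
qed

text \<open>One-sided powers keep the scaling constant finite for an easy reason: only the behaviour at
  \<open>0\<close> and at infinity of \<open>r powr (-(1 + \<alpha>) / 2) * (1 + r) powr (-(1 + \<alpha>) / 2)\<close> matters.\<close>

lemma riesz_kernel_factorization:
  fixes u v \<alpha> :: real
  assumes \<alpha>: "0 < \<alpha>" "\<alpha> < 1" and "u \<noteq> v"
  defines "f \<equiv> \<lambda>r::real. indicator {0<..} r * (r powr (-(1 + \<alpha>) / 2) * (1 + r) powr (-(1 + \<alpha>) / 2))"
    and "\<phi> \<equiv> \<lambda>u t. indicator {..<u} t * (u - t) powr (-(1 + \<alpha>) / 2)"
  shows "(\<integral>\<^sup>+t. ennreal (\<phi> u t * \<phi> v t) \<partial>lborel) = ennreal (integral\<^sup>L lborel f * \<bar>u - v\<bar> powr (-\<alpha>))"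
proof -
  have *: "(\<integral>\<^sup>+t. ennreal (\<phi> u t * \<phi> v t) \<partial>lborel) = ennreal (integral\<^sup>L lborel f * \<bar>u - v\<bar> powr (-\<alpha>))"
    if "u < v" for u v
  proof -
    define d where "d = v - u"
    have d: "0 < d" using that by (simp add: d_def)
    \<comment> \<open>Putting t = u - d r measures distances in units of d = v - u: the two powers
      give d^-(1 + \<alpha>), and the Jacobian d turns this into d^-\<alpha>.\<close>
    have f: "\<phi> u (u + (-d) * r) * \<phi> v (u + (-d) * r) = d powr (-(1 + \<alpha>)) * f r" for r
    proof (cases "0 < r")
      case True
      with d have dr: "0 < d * r" by simp
      have "\<phi> u (u + (-d) * r) * \<phi> v (u + (-d) * r) = (d * r) powr (-(1 + \<alpha>) / 2) * (d * (1 + r)) powr (-(1 + \<alpha>) / 2)"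
        using dr d unfolding \<phi>_def by (auto simp: d_def indicator_def algebra_simps)
      also have "\<dots> = (d powr (-(1 + \<alpha>) / 2) * d powr (-(1 + \<alpha>) / 2)) * f r"
        using d True by (simp add: powr_mult f_def)
      also have "d powr (-(1 + \<alpha>) / 2) * d powr (-(1 + \<alpha>) / 2) = d powr (-(1 + \<alpha>))"
        by (simp only: powr_add[symmetric] field_sum_of_halves)
      finally show ?thesis .
    next
      case False
      with d have "d * r \<le> 0" by (simp add: mult_nonneg_nonpos)
      with False show ?thesis by (simp add: \<phi>_def f_def)
    qed
    have "(\<integral>\<^sup>+t. ennreal (\<phi> u t * \<phi> v t) \<partial>lborel)
        = ennreal \<bar>-d\<bar> * (\<integral>\<^sup>+r. ennreal (\<phi> u (u + (-d) * r) * \<phi> v (u + (-d) * r)) \<partial>lborel)"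
      by (rule nn_integral_real_affine) (use d in \<open>auto simp: \<phi>_def\<close>)
    also have "\<dots> = ennreal d * (\<integral>\<^sup>+r. ennreal (d powr (-(1 + \<alpha>)) * f r) \<partial>lborel)"
      unfolding f using d by simp
    also have "(\<integral>\<^sup>+r. ennreal (d powr (-(1 + \<alpha>)) * f r) \<partial>lborel) = ennreal (LINT r|lborel. d powr (-(1 + \<alpha>)) * f r)"
      using riesz_const(1)[OF \<alpha>] unfolding f_def by (intro nn_integral_eq_integral integrable_mult_right) auto
    also have "ennreal d * \<dots> = ennreal (d * (d powr (-(1 + \<alpha>)) * integral\<^sup>L lborel f))"
      using d by (subst ennreal_mult'[symmetric]) auto
    also have "d * (d powr (-(1 + \<alpha>)) * integral\<^sup>L lborel f) = integral\<^sup>L lborel f * (d powr 1 * d powr (-(1 + \<alpha>)))"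
      using d by simp
    also have "d powr 1 * d powr (-(1 + \<alpha>)) = d powr (-\<alpha>)"
      by (subst powr_add[symmetric]) simp
    finally show ?thesis using d by (simp add: d_def abs_minus_commute)
  qed
  show ?thesis
    using *[of u v] *[of v u] \<open>u \<noteq> v\<close> by (cases "u < v") (auto simp: mult.commute abs_minus_commute)
qed

text \<open>A square root of the kernel: the inner product over \<open>t\<close> of the functions
  belonging to \<open>u\<close> and \<open>v\<close> is to be
  \<open>riesz_kernel \<alpha> u v\<close>. At \<open>\<alpha> = 0\<close> the normalizing integral
  diverges, so a fixed function of norm 1 replaces the power.\<close>

definition riesz_root :: "real \<Rightarrow> real \<Rightarrow> real \<Rightarrow> real" where
  "riesz_root \<alpha> u t = (if \<alpha> = 0 then indicator {0..1} t else
     indicator {..<u} t * (u - t) powr (-(1 + \<alpha>) / 2) /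
       sqrt (LINT r|lborel. indicator {0<..} r * (r powr (-(1 + \<alpha>) / 2) * (1 + r) powr (-(1 + \<alpha>) / 2))))"

lemma riesz_root_nonneg [simp]: "0 \<le> riesz_root \<alpha> u t"
  unfolding riesz_root_def by (auto intro!: divide_nonneg_nonneg integral_nonneg)

lemma borel_measurable_riesz_root [measurable]:
  "(\<lambda>(u, t). riesz_root \<alpha> u t) \<in> borel_measurable (borel \<Otimes>\<^sub>M borel)"
proof -
  have "(\<lambda>(u, t). riesz_root \<alpha> u t) = (\<lambda>(u, t). (if \<alpha> = 0 then indicator {0..1} t else
     (if t < u then (u - t) powr (-(1 + \<alpha>) / 2) else 0) /
       sqrt (LINT r|lborel. indicator {0<..} r * (r powr (-(1 + \<alpha>) / 2) * (1 + r) powr (-(1 + \<alpha>) / 2)))))"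
    by (auto simp: riesz_root_def fun_eq_iff)
  also have "\<dots> \<in> borel_measurable (borel \<Otimes>\<^sub>M borel)" by measurable
  finally show ?thesis .
qed

text \<open>For \<open>\<alpha> > 0\<close> the diagonal has to be left out: there the integral is
  infinite, whereas \<open>riesz_kernel\<close> is 0.\<close>

lemma nn_integral_riesz_root:
  assumes "0 \<le> \<alpha>" "\<alpha> < 1" "u \<noteq> v \<or> \<alpha> = 0"
  shows "(\<integral>\<^sup>+t. ennreal (riesz_root \<alpha> u t * riesz_root \<alpha> v t) \<partial>lborel) = ennreal (riesz_kernel \<alpha> u v)"
proof (cases "\<alpha> = 0")
  case True
  then show ?thesis
    by (simp add: riesz_root_def riesz_kernel_def ennreal_indicator flip: indicator_inter_arith)
next
  case False
  with assms have \<alpha>: "0 < \<alpha>" "\<alpha> < 1" "u \<noteq> v" by auto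
  define C where "C = (LINT r|lborel. indicator {0<..} r * (r powr (-(1 + \<alpha>) / 2) * (1 + r) powr (-(1 + \<alpha>) / 2)))"
  have C: "0 < C" unfolding C_def by (rule riesz_const(2)[OF \<alpha>(1,2)])
  define \<phi> where "\<phi> = (\<lambda>u t::real. indicator {..<u} t * (u - t) powr (-(1 + \<alpha>) / 2))"
  have "riesz_root \<alpha> u t * riesz_root \<alpha> v t = 1 / C * (\<phi> u t * \<phi> v t)" for t
  proof -
    have "riesz_root \<alpha> w t = \<phi> w t / sqrt C" for w
      unfolding riesz_root_def C_def \<phi>_def using False by simp
    then show ?thesis using C by simp
  qed
  then have "(\<integral>\<^sup>+t. ennreal (riesz_root \<alpha> u t * riesz_root \<alpha> v t) \<partial>lborel)
      = (\<integral>\<^sup>+t. ennreal (1 / C) * ennreal (\<phi> u t * \<phi> v t) \<partial>lborel)"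
    using C by (simp only: ennreal_mult' divide_nonneg_nonneg zero_le_one less_imp_le)
  also have "\<dots> = ennreal (1 / C) * (\<integral>\<^sup>+t. ennreal (\<phi> u t * \<phi> v t) \<partial>lborel)"
    by (rule nn_integral_cmult) (simp add: \<phi>_def)
  also have "(\<integral>\<^sup>+t. ennreal (\<phi> u t * \<phi> v t) \<partial>lborel) = ennreal (C * \<bar>u - v\<bar> powr (-\<alpha>))"
    unfolding \<phi>_def C_def by (rule riesz_kernel_factorization[OF \<alpha>])
  also have "ennreal (1 / C) * \<dots> = ennreal (riesz_kernel \<alpha> u v)"
    using C False by (subst ennreal_mult'[symmetric]) (auto simp: riesz_kernel_def)
  finally show ?thesis .
qed

text \<open>Fubini for a factored kernel: the energy becomes an integral over \<open>T\<close> of a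
  product of two transforms, which is a square when both measures and both functions coincide.
  Distinct measures are allowed for the mixed term. As the factors are nonnegative, Tonelli and the
  bounds on \<open>g\<close> and \<open>h\<close> reduce absolute integrability to that of
  \<open>k\<close>.\<close>

lemma integral_factored_kernel:
  fixes \<phi>\<mu> :: "'a \<Rightarrow> 'c \<Rightarrow> real" and \<phi>\<nu> :: "'b \<Rightarrow> 'c \<Rightarrow> real"
  assumes \<mu>: "finite_measure \<mu>" and \<nu>: "finite_measure \<nu>" and T: "sigma_finite_measure T"
    and [measurable]: "case_prod \<phi>\<mu> \<in> borel_measurable (\<mu> \<Otimes>\<^sub>M T)" "case_prod \<phi>\<nu> \<in> borel_measurable (\<nu> \<Otimes>\<^sub>M T)"
    and \<phi>0: "\<And>u t. 0 \<le> \<phi>\<mu> u t" "\<And>v t. 0 \<le> \<phi>\<nu> v t"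
    and k: "integrable (\<mu> \<Otimes>\<^sub>M \<nu>) (case_prod k)" and k0: "\<And>u v. 0 \<le> k u v"
    and fac: "AE (u, v) in \<mu> \<Otimes>\<^sub>M \<nu>. (\<integral>\<^sup>+t. ennreal (\<phi>\<mu> u t * \<phi>\<nu> v t) \<partial>T) = ennreal (k u v)"
    and [measurable]: "g \<in> borel_measurable \<mu>" "h \<in> borel_measurable \<nu>"
    and g: "\<And>u. u \<in> space \<mu> \<Longrightarrow> \<bar>g u\<bar> \<le> G" and h: "\<And>v. v \<in> space \<nu> \<Longrightarrow> \<bar>h v\<bar> \<le> H"
  shows "integrable T (\<lambda>t. (LINT u|\<mu>. \<phi>\<mu> u t * g u) * (LINT v|\<nu>. \<phi>\<nu> v t * h v))"
    and "(LINT p|(\<mu> \<Otimes>\<^sub>M \<nu>). k (fst p) (snd p) * (g (fst p) * h (snd p)))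
      = (LINT t|T. (LINT u|\<mu>. \<phi>\<mu> u t * g u) * (LINT v|\<nu>. \<phi>\<nu> v t * h v))"
proof -
  interpret \<mu>: finite_measure \<mu> by fact
  interpret \<nu>: finite_measure \<nu> by fact
  interpret T: sigma_finite_measure T by fact
  interpret \<mu>\<nu>: pair_sigma_finite \<mu> \<nu> ..
  interpret P: sigma_finite_measure "\<mu> \<Otimes>\<^sub>M \<nu>" by (intro sigma_finite_pair_measure \<mu>.sigma_finite_measure \<nu>.sigma_finite_measure)
  interpret PT: pair_sigma_finite "\<mu> \<Otimes>\<^sub>M \<nu>" T ..
  define \<Psi> where "\<Psi> = (\<lambda>x. \<phi>\<mu> (fst (fst x)) (snd x) * \<phi>\<nu> (snd (fst x)) (snd x) * (g (fst (fst x)) * h (snd (fst x))))"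
  have [measurable]: "(\<lambda>x. k (fst x) (snd x)) \<in> borel_measurable (\<mu> \<Otimes>\<^sub>M \<nu>)"
    using borel_measurable_integrable[OF k] by (simp add: case_prod_unfold)
  have [measurable]:
    "(\<lambda>x. \<phi>\<mu> (fst (fst x)) (snd x)) \<in> borel_measurable ((\<mu> \<Otimes>\<^sub>M \<nu>) \<Otimes>\<^sub>M T)"
    "(\<lambda>x. \<phi>\<nu> (snd (fst x)) (snd x)) \<in> borel_measurable ((\<mu> \<Otimes>\<^sub>M \<nu>) \<Otimes>\<^sub>M T)"
    using measurable_compose[OF _ assms(4), of "\<lambda>x. (fst (fst x), snd x)" "(\<mu> \<Otimes>\<^sub>M \<nu>) \<Otimes>\<^sub>M T"]
      measurable_compose[OF _ assms(5), of "\<lambda>x. (snd (fst x), snd x)" "(\<mu> \<Otimes>\<^sub>M \<nu>) \<Otimes>\<^sub>M T"] by simp_all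
  have [measurable]: "\<Psi> \<in> borel_measurable ((\<mu> \<Otimes>\<^sub>M \<nu>) \<Otimes>\<^sub>M T)"
    unfolding \<Psi>_def by measurable
  have \<Psi>: "integrable ((\<mu> \<Otimes>\<^sub>M \<nu>) \<Otimes>\<^sub>M T) \<Psi>"
  proof (rule integrableI_bounded)
    have "(\<integral>\<^sup>+x. ennreal (norm (\<Psi> x)) \<partial>((\<mu> \<Otimes>\<^sub>M \<nu>) \<Otimes>\<^sub>M T))
        = (\<integral>\<^sup>+p. \<integral>\<^sup>+t. ennreal (norm (\<Psi> (p, t))) \<partial>T \<partial>(\<mu> \<Otimes>\<^sub>M \<nu>))"
      by (intro T.nn_integral_fst[symmetric]) measurable
    also have "\<dots> \<le> (\<integral>\<^sup>+p. ennreal (G * H) * ennreal (case_prod k p) \<partial>(\<mu> \<Otimes>\<^sub>M \<nu>))"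
    proof (rule nn_integral_mono_AE)
      from fac AE_space show "AE p in \<mu> \<Otimes>\<^sub>M \<nu>. (\<integral>\<^sup>+t. ennreal (norm (\<Psi> (p, t))) \<partial>T) \<le> ennreal (G * H) * ennreal (case_prod k p)"
      proof eventually_elim
        case (elim p)
        obtain u v where p: "p = (u, v)" by force
        with elim have uv: "u \<in> space \<mu>" "v \<in> space \<nu>" by (auto simp: space_pair_measure)
        have gh: "\<bar>g u * h v\<bar> \<le> G * H"
          unfolding abs_mult using g[OF uv(1)] h[OF uv(2)] by (intro mult_mono) auto
        have "(\<integral>\<^sup>+t. ennreal (norm (\<Psi> (p, t))) \<partial>T) = (\<integral>\<^sup>+t. ennreal \<bar>g u * h v\<bar> * ennreal (\<phi>\<mu> u t * \<phi>\<nu> v t) \<partial>T)"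
          by (intro nn_integral_cong) (simp add: \<Psi>_def p abs_mult \<phi>0 mult_ac flip: ennreal_mult')
        also have "\<dots> = ennreal \<bar>g u * h v\<bar> * (\<integral>\<^sup>+t. ennreal (\<phi>\<mu> u t * \<phi>\<nu> v t) \<partial>T)"
          using uv by (intro nn_integral_cmult) measurable
        also have "\<dots> = ennreal \<bar>g u * h v\<bar> * ennreal (case_prod k p)"
          using elim p by simp
        also have "\<dots> \<le> ennreal (G * H) * ennreal (case_prod k p)"
          using gh by (intro mult_right_mono ennreal_leI) auto
        finally show ?case .
      qed
    qed
    also have "\<dots> = ennreal (G * H) * (\<integral>\<^sup>+p. ennreal (case_prod k p) \<partial>(\<mu> \<Otimes>\<^sub>M \<nu>))"
      using k by (intro nn_integral_cmult) auto
    also have "\<dots> < \<infinity>"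
      using k unfolding integrable_iff_bounded by (auto simp: case_prod_unfold k0 ennreal_mult_less_top)
    finally show "(\<integral>\<^sup>+x. ennreal (norm (\<Psi> x)) \<partial>((\<mu> \<Otimes>\<^sub>M \<nu>) \<Otimes>\<^sub>M T)) < \<infinity>" .
  qed measurable
  have \<Psi>': "integrable ((\<mu> \<Otimes>\<^sub>M \<nu>) \<Otimes>\<^sub>M T) (case_prod (\<lambda>p t. \<Psi> (p, t)))"
    using \<Psi> by simp
  \<comment> \<open>Only for almost every \<open>t\<close> is the section integrable, so the
    splitting into a product holds almost everywhere; measurability of the product is therefore
    supplied separately.\<close>
  have prod: "AE t in T. (LINT p|(\<mu> \<Otimes>\<^sub>M \<nu>). \<Psi> (p, t)) = (LINT u|\<mu>. \<phi>\<mu> u t * g u) * (LINT v|\<nu>. \<phi>\<nu> v t * h v)"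
    using PT.AE_integrable_snd[OF \<Psi>']
  proof eventually_elim
    case (elim t)
    have "(LINT p|(\<mu> \<Otimes>\<^sub>M \<nu>). \<Psi> (p, t)) = (LINT u|\<mu>. LINT v|\<nu>. \<Psi> ((u, v), t))"
      using \<mu>\<nu>.integral_fst'[OF elim] by simp
    also have "\<dots> = (LINT u|\<mu>. (\<phi>\<mu> u t * g u) * (LINT v|\<nu>. \<phi>\<nu> v t * h v))"
      by (subst integral_mult_right_zero[symmetric]) (simp add: \<Psi>_def mult_ac)
    also have "\<dots> = (LINT u|\<mu>. \<phi>\<mu> u t * g u) * (LINT v|\<nu>. \<phi>\<nu> v t * h v)"
      by simp
    finally show ?case .
  qed
  have mF: "(\<lambda>t. LINT u|\<mu>. \<phi>\<mu> u t * g u) \<in> borel_measurable T"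
    and mH: "(\<lambda>t. LINT v|\<nu>. \<phi>\<nu> v t * h v) \<in> borel_measurable T"
    by measurable
  note m = borel_measurable_times[OF mF mH]
  have int: "integrable T (\<lambda>t. LINT p|(\<mu> \<Otimes>\<^sub>M \<nu>). \<Psi> (p, t))"
    using PT.integrable_snd[OF \<Psi>'] .
  show "integrable T (\<lambda>t. (LINT u|\<mu>. \<phi>\<mu> u t * g u) * (LINT v|\<nu>. \<phi>\<nu> v t * h v))"
    using int by (rule integrable_cong_AE_imp[OF _ m]) (use prod in auto)
  have "(LINT p|(\<mu> \<Otimes>\<^sub>M \<nu>). k (fst p) (snd p) * (g (fst p) * h (snd p))) = (LINT p|(\<mu> \<Otimes>\<^sub>M \<nu>). LINT t|T. \<Psi> (p, t))"
  proof (rule integral_cong_AE)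
    from fac AE_space show "AE p in \<mu> \<Otimes>\<^sub>M \<nu>. k (fst p) (snd p) * (g (fst p) * h (snd p)) = (LINT t|T. \<Psi> (p, t))"
    proof eventually_elim
      case (elim p)
      obtain u v where p: "p = (u, v)" by force
      with elim have uv: "u \<in> space \<mu>" "v \<in> space \<nu>" by (auto simp: space_pair_measure)
      have "(LINT t|T. \<phi>\<mu> u t * \<phi>\<nu> v t) = k u v"
        using elim p uv \<phi>0 k0 by (subst integral_eq_nn_integral) auto
      then show ?case by (simp add: \<Psi>_def p)
    qed
  qed (auto simp: case_prod_unfold)
  also have "\<dots> = (LINT t|T. LINT p|(\<mu> \<Otimes>\<^sub>M \<nu>). \<Psi> (p, t))"
    using PT.Fubini_integral[OF \<Psi>'] by simp
  also have "\<dots> = (LINT t|T. (LINT u|\<mu>. \<phi>\<mu> u t * g u) * (LINT v|\<nu>. \<phi>\<nu> v t * h v))"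
    using prod m borel_measurable_integrable[OF int] by (intro integral_cong_AE) auto
  finally show "(LINT p|(\<mu> \<Otimes>\<^sub>M \<nu>). k (fst p) (snd p) * (g (fst p) * h (snd p)))
      = (LINT t|T. (LINT u|\<mu>. \<phi>\<mu> u t * g u) * (LINT v|\<nu>. \<phi>\<nu> v t * h v))" .
qed

lemma riesz_kernel_nonneg [simp]: "0 \<le> riesz_kernel \<alpha> u v"
  by (simp add: riesz_kernel_def)

lemma borel_measurable_riesz_kernel [measurable (raw)]:
  assumes [measurable]: "f \<in> borel_measurable M" "g \<in> borel_measurable M"
  shows "(\<lambda>x. riesz_kernel \<alpha> (f x) (g x)) \<in> borel_measurable M"
  unfolding riesz_kernel_def by measurable

lemma power_kernel_eq_riesz:
  assumes "u \<noteq> v \<or> \<alpha> = 0"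
  shows "power_kernel \<gamma> \<beta> \<alpha> u v = ereal (\<gamma> + \<beta> * riesz_kernel \<alpha> u v)"
  using assms by (auto simp: power_kernel_def riesz_kernel_def powr_minus divide_inverse)

text \<open>With \<open>F\<close> and \<open>F'\<close> the transforms of g \<mu> and h \<nu>, the
  three terms add up to the integral of \<open>(F t - F' t)\<^sup>2\<close>. The signed measure g
  \<mu> - h \<nu> itself is never formed.\<close>

lemma riesz_energy_nonneg:
  fixes \<mu> \<nu> :: "real measure" and g h :: "real \<Rightarrow> real"
  assumes \<alpha>: "0 \<le> \<alpha>" "\<alpha> < 1"
    and \<mu>: "finite_measure \<mu>" "(\<lambda>x. x) \<in> borel_measurable \<mu>"
    and \<nu>: "finite_measure \<nu>" "(\<lambda>x. x) \<in> borel_measurable \<nu>"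
    and int: "integrable (\<mu> \<Otimes>\<^sub>M \<mu>) (\<lambda>p. riesz_kernel \<alpha> (fst p) (snd p))"
      "integrable (\<mu> \<Otimes>\<^sub>M \<nu>) (\<lambda>p. riesz_kernel \<alpha> (fst p) (snd p))"
      "integrable (\<nu> \<Otimes>\<^sub>M \<nu>) (\<lambda>p. riesz_kernel \<alpha> (fst p) (snd p))"
    and diag: "AE p in \<mu> \<Otimes>\<^sub>M \<mu>. fst p \<noteq> snd p \<or> \<alpha> = 0"
      "AE p in \<mu> \<Otimes>\<^sub>M \<nu>. fst p \<noteq> snd p \<or> \<alpha> = 0"
      "AE p in \<nu> \<Otimes>\<^sub>M \<nu>. fst p \<noteq> snd p \<or> \<alpha> = 0"
    and gh: "g \<in> borel_measurable \<mu>" "h \<in> borel_measurable \<nu>"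
    and g: "\<And>u. u \<in> space \<mu> \<Longrightarrow> \<bar>g u\<bar> \<le> G" and h: "\<And>v. v \<in> space \<nu> \<Longrightarrow> \<bar>h v\<bar> \<le> H"
  shows "0 \<le> (LINT p|(\<mu> \<Otimes>\<^sub>M \<mu>). riesz_kernel \<alpha> (fst p) (snd p) * (g (fst p) * g (snd p)))
     - 2 * (LINT p|(\<mu> \<Otimes>\<^sub>M \<nu>). riesz_kernel \<alpha> (fst p) (snd p) * (g (fst p) * h (snd p)))
     + (LINT p|(\<nu> \<Otimes>\<^sub>M \<nu>). riesz_kernel \<alpha> (fst p) (snd p) * (h (fst p) * h (snd p)))"
proof -
  define F where "F t = (LINT u|\<mu>. riesz_root \<alpha> u t * g u)" for t
  define F' where "F' t = (LINT v|\<nu>. riesz_root \<alpha> v t * h v)" for t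
  have meas: "case_prod (riesz_root \<alpha>) \<in> borel_measurable (\<rho> \<Otimes>\<^sub>M lborel)"
    if "(\<lambda>x. x) \<in> borel_measurable \<rho>" for \<rho>
  proof -
    have "(\<lambda>p. (fst p, snd p)) \<in> \<rho> \<Otimes>\<^sub>M lborel \<rightarrow>\<^sub>M borel \<Otimes>\<^sub>M borel"
      using measurable_compose[OF measurable_fst that] by (intro measurable_Pair) auto
    from measurable_compose[OF this borel_measurable_riesz_root] show ?thesis
      by (simp add: case_prod_unfold)
  qed
  have fac: "AE (u, v) in \<rho>. (\<integral>\<^sup>+t. ennreal (riesz_root \<alpha> u t * riesz_root \<alpha> v t) \<partial>lborel) = ennreal (riesz_kernel \<alpha> u v)"
    if "AE p in \<rho>. fst p \<noteq> snd p \<or> \<alpha> = 0" for \<rho>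
    using that by eventually_elim (auto intro!: nn_integral_riesz_root[OF \<alpha>])
  note factored = integral_factored_kernel[where \<phi>\<mu> = "riesz_root \<alpha>" and \<phi>\<nu> = "riesz_root \<alpha>"
      and k = "riesz_kernel \<alpha>", OF _ _ lborel.sigma_finite_measure_axioms]
  have gg: "integrable lborel (\<lambda>t. F t * F t)"
    "(LINT p|(\<mu> \<Otimes>\<^sub>M \<mu>). riesz_kernel \<alpha> (fst p) (snd p) * (g (fst p) * g (snd p))) = (LINT t|lborel. F t * F t)"
    unfolding F_def
    by (rule factored[where g = g and h = g and G = G and H = G]; use \<mu> gh g int(1) fac[OF diag(1)] meas in \<open>simp add: case_prod_unfold\<close>)+
  have gh: "integrable lborel (\<lambda>t. F t * F' t)"
    "(LINT p|(\<mu> \<Otimes>\<^sub>M \<nu>). riesz_kernel \<alpha> (fst p) (snd p) * (g (fst p) * h (snd p))) = (LINT t|lborel. F t * F' t)"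
    unfolding F_def F'_def
    by (rule factored[where g = g and h = h and G = G and H = H]; use \<mu> \<nu> gh g h int(2) fac[OF diag(2)] meas in \<open>simp add: case_prod_unfold\<close>)+
  have hh: "integrable lborel (\<lambda>t. F' t * F' t)"
    "(LINT p|(\<nu> \<Otimes>\<^sub>M \<nu>). riesz_kernel \<alpha> (fst p) (snd p) * (h (fst p) * h (snd p))) = (LINT t|lborel. F' t * F' t)"
    unfolding F'_def
    by (rule factored[where g = h and h = h and G = H and H = H]; use \<nu> \<open>h \<in> borel_measurable \<nu>\<close> h int(3) fac[OF diag(3)] meas in \<open>simp add: case_prod_unfold\<close>)+
  have "0 \<le> (LINT t|lborel. (F t - F' t)\<^sup>2)" by simp
  also have "\<dots> = (LINT t|lborel. F t * F t - 2 * (F t * F' t) + F' t * F' t)"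
    by (simp add: power2_eq_square algebra_simps)
  also have "\<dots> = (LINT t|lborel. F t * F t) - 2 * (LINT t|lborel. F t * F' t) + (LINT t|lborel. F' t * F' t)"
    using gg(1) gh(1) hh(1) by (simp add: Bochner_Integration.integral_add Bochner_Integration.integral_diff)
  finally show ?thesis unfolding gg(2) gh(2) hh(2) .
qed

section \<open>Designs and their energies\<close>

lemma is_designD:
  assumes "is_design \<xi>"
  shows "prob_space \<xi>" "space \<xi> = {-1..1}" "f \<in> borel_measurable borel \<Longrightarrow> f \<in> borel_measurable \<xi>"
    "finite_measure \<xi>"
proof -
  show p: "prob_space \<xi>" using assms by (simp add: is_design_def)
  then show "finite_measure \<xi>" by (simp add: prob_space_def)
  have s: "sets \<xi> = sets (restrict_space borel {-1..1})" using assms by (simp add: is_design_def)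
  from sets_eq_imp_space_eq[OF s] show "space \<xi> = {-1..1}" by (simp add: space_restrict_space)
  show "f \<in> borel_measurable \<xi>" if "f \<in> borel_measurable borel"
    using measurable_restrict_space1[OF that, of "{-1..1}"] measurable_cong_sets[OF s refl] by blast
qed

text \<open>The integrable potential at 0 dominates the weight, since
  \<open>\<bar>u\<bar> powr (-\<alpha>)\<close> is at least 1 for
  \<open>0 < \<bar>u\<bar> < 1\<close>. Positivity: the exponent is negative, so the weight is at
  least 1 on the open interval.\<close>

lemma arcsine_weight_mass:
  assumes \<alpha>: "0 \<le> \<alpha>" "\<alpha> < 1"
  shows "integrable lborel (arcsine_weight \<alpha>)" and "0 < integral\<^sup>L lborel (arcsine_weight \<alpha>)"
proof -
  have I: "integrable lborel (\<lambda>u. arcsine_weight \<alpha> u * \<bar>u ^ 0\<bar> * \<bar>u - 0\<bar> powr (-\<alpha>))"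
    using \<alpha> by (intro integrable_arcsine_potential) auto
  show int: "integrable lborel (arcsine_weight \<alpha>)"
  proof (rule Bochner_Integration.integrable_bound[OF I])
    show "AE u in lborel. norm (arcsine_weight \<alpha> u) \<le> norm (arcsine_weight \<alpha> u * \<bar>u ^ 0\<bar> * \<bar>u - 0\<bar> powr (-\<alpha>))"
      using AE_lborel_singleton[of 0]
    proof eventually_elim
      case (elim u)
      show ?case
      proof (cases "u \<in> {-1<..<1}")
        case True
        then have "1 powr (-\<alpha>) \<le> \<bar>u\<bar> powr (-\<alpha>)"
          using elim \<alpha> by (intro powr_mono2') auto
        then have "arcsine_weight \<alpha> u * 1 \<le> arcsine_weight \<alpha> u * \<bar>u\<bar> powr (-\<alpha>)"
          by (intro mult_left_mono) auto
        then show ?thesis by (simp add: abs_mult)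
      qed (simp add: arcsine_weight_def)
    qed
  qed simp
  have "0 < measure lborel {-1<..<1::real}" by simp
  also have "\<dots> = (LINT u|lborel. indicator {-1<..<1::real} u)" by simp
  also have "\<dots> \<le> integral\<^sup>L lborel (arcsine_weight \<alpha>)"
  proof (intro integral_mono int integrable_real_indicator)
    fix u :: real
    show "indicator {-1<..<1} u \<le> arcsine_weight \<alpha> u"
    proof (cases "u \<in> {-1<..<1}")
      case True
      then have "1 powr ((\<alpha> - 1) / 2) \<le> (1 - u\<^sup>2) powr ((\<alpha> - 1) / 2)"
        using \<alpha> by (intro powr_mono2') (auto simp: abs_square_less_1 abs_less_iff)
      with True show ?thesis by (simp add: arcsine_weight_def)
    qed (simp add: arcsine_weight_def)
  qed auto
  finally show "0 < integral\<^sup>L lborel (arcsine_weight \<alpha>)" .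
qed

text \<open>At the endpoints the base of the power is 0, and \<open>0 powr\<close> any exponent is
  0.\<close>

lemma indicator_arcsine_weight:
  "indicator {-1..1} u * (1 - u\<^sup>2) powr ((\<alpha> - 1) / 2) = arcsine_weight \<alpha> u"
proof -
  have "u = 1 \<or> u = -1" if "u \<in> {-1..1}" "u \<notin> {-1<..<1}" using that by auto
  then show ?thesis by (auto simp: arcsine_weight_def indicator_def)
qed

lemma arcsine_const_eq: "arcsine_const \<alpha> = 1 / integral\<^sup>L lborel (arcsine_weight \<alpha>)"
  by (simp add: arcsine_const_def integral_restrict_space indicator_arcsine_weight)

lemma arcsine_design_integral:
  fixes f :: "real \<Rightarrow> real"
  assumes \<alpha>: "0 \<le> \<alpha>" "\<alpha> < 1" and [measurable]: "f \<in> borel_measurable borel"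
  shows "integrable (arcsine_design \<alpha>) f \<longleftrightarrow> integrable lborel (\<lambda>u. arcsine_weight \<alpha> u * f u)"
    and "integral\<^sup>L (arcsine_design \<alpha>) f = arcsine_const \<alpha> * (LINT u|lborel. arcsine_weight \<alpha> u * f u)"
proof -
  have c: "0 < arcsine_const \<alpha>" using arcsine_weight_mass[OF \<alpha>] by (simp add: arcsine_const_eq)
  have m: "f \<in> borel_measurable (restrict_space lborel {-1..1})"
    "arcsine_density \<alpha> \<in> borel_measurable (restrict_space lborel {-1..1})"
    by (auto intro!: measurable_restrict_space1 simp: arcsine_density_def[abs_def])
  have nn: "AE x in restrict_space lborel {-1..1}. 0 \<le> arcsine_density \<alpha> x"
    using c by (intro AE_I2) (simp add: arcsine_density_def)
  have eq: "indicator {-1..1} u * (arcsine_density \<alpha> u * f u) = arcsine_const \<alpha> * (arcsine_weight \<alpha> u * f u)" for u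
    by (simp add: arcsine_density_def indicator_arcsine_weight[symmetric])
  show "integrable (arcsine_design \<alpha>) f \<longleftrightarrow> integrable lborel (\<lambda>u. arcsine_weight \<alpha> u * f u)"
    unfolding arcsine_design_def integrable_density[OF m nn]
    using c by (simp add: integrable_restrict_space eq mult.assoc)
  show "integral\<^sup>L (arcsine_design \<alpha>) f = arcsine_const \<alpha> * (LINT u|lborel. arcsine_weight \<alpha> u * f u)"
    unfolding arcsine_design_def integral_density[OF m nn]
    by (simp add: integral_restrict_space eq mult.assoc)
qed

lemma is_design_arcsine:
  assumes \<alpha>: "0 \<le> \<alpha>" "\<alpha> < 1"
  shows "is_design (arcsine_design \<alpha>)"
  unfolding is_design_def
proof
  have c: "0 < arcsine_const \<alpha>" using arcsine_weight_mass[OF \<alpha>] by (simp add: arcsine_const_eq)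
  have "emeasure (arcsine_design \<alpha>) (space (arcsine_design \<alpha>))
      = (\<integral>\<^sup>+x. ennreal (arcsine_density \<alpha> x) \<partial>restrict_space lborel {-1..1})"
    unfolding arcsine_design_def
    by (subst emeasure_density) (auto intro!: nn_integral_cong measurable_restrict_space1 simp: arcsine_density_def[abs_def] sets_restrict_space_iff)
  also have "\<dots> = (\<integral>\<^sup>+x. ennreal (arcsine_const \<alpha> * arcsine_weight \<alpha> x) \<partial>lborel)"
    by (subst nn_integral_restrict_space)
       (auto intro!: nn_integral_cong simp: arcsine_density_def indicator_arcsine_weight[symmetric] indicator_def)
  also have "\<dots> = ennreal (LINT x|lborel. arcsine_const \<alpha> * arcsine_weight \<alpha> x)"
    using arcsine_weight_mass(1)[OF \<alpha>] c by (intro nn_integral_eq_integral integrable_mult_right) auto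
  also have "(LINT x|lborel. arcsine_const \<alpha> * arcsine_weight \<alpha> x) = 1"
    using arcsine_weight_mass(2)[OF \<alpha>] by (simp add: arcsine_const_eq)
  finally show "prob_space (arcsine_design \<alpha>)" by (intro prob_spaceI) simp
  show "sets (arcsine_design \<alpha>) = sets (restrict_space borel {-1..1})"
    unfolding arcsine_design_def by (simp add: sets_restrict_space)
qed

text \<open>For \<open>\<alpha> > 0\<close> designs with atoms have infinite energy; for \<open>\<alpha> = 0\<close> they are admissible.\<close>

definition diffuse_design :: "real \<Rightarrow> real measure \<Rightarrow> bool" where
  "diffuse_design \<alpha> \<xi> \<longleftrightarrow> is_design \<xi> \<and> (\<alpha> = 0 \<or> (\<forall>x\<in>{-1..1}. emeasure \<xi> {x} = 0))"

lemma emeasure_arcsine_singleton: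
  assumes "x \<in> {-1..1}"
  shows "emeasure (arcsine_design \<alpha>) {x} = 0"
proof -
  have "emeasure (arcsine_design \<alpha>) {x} =
     (\<integral>\<^sup>+y. ennreal (arcsine_density \<alpha> y) * indicator {x} y \<partial>restrict_space lborel {-1..1})"
    unfolding arcsine_design_def using assms
    by (intro emeasure_density) (auto intro!: measurable_restrict_space1 simp: arcsine_density_def[abs_def] sets_restrict_space_iff)
  also have "\<dots> = 0"
  proof (subst nn_integral_0_iff_AE)
    show "AE y in restrict_space lborel {-1..1}. ennreal (arcsine_density \<alpha> y) * indicator {x} y = 0"
      using AE_lborel_singleton[of x] by (subst AE_restrict_space_iff) (auto elim!: eventually_mono)
  qed (auto intro!: measurable_restrict_space1 simp: arcsine_density_def[abs_def])
  finally show ?thesis .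
qed

lemma diffuse_design_arcsine:
  assumes \<alpha>: "0 \<le> \<alpha>" "\<alpha> < 1"
  shows "diffuse_design \<alpha> (arcsine_design \<alpha>)"
  using is_design_arcsine[OF \<alpha>] emeasure_arcsine_singleton by (simp add: diffuse_design_def)

lemma diffuse_design_AE:
  assumes "diffuse_design \<alpha> \<xi>"
  shows "x \<in> {-1..1} \<Longrightarrow> AE y in \<xi>. x \<noteq> y \<or> \<alpha> = 0"
    and "AE y in \<xi>. -1 < y \<and> y < 1 \<or> \<alpha> = 0"
proof -
  have d: "is_design \<xi>" using assms by (simp add: diffuse_design_def)
  have *: "AE y in \<xi>. x \<noteq> y \<or> \<alpha> = 0" if "x \<in> {-1..1}" for x
  proof (cases "\<alpha> = 0")
    case False
    have "{x} \<in> sets \<xi>"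
      using d that by (auto simp: is_design_def sets_restrict_space_iff)
    with assms False that have "{x} \<in> null_sets \<xi>" by (auto simp: diffuse_design_def)
    from AE_not_in[OF this] show ?thesis by eventually_elim auto
  qed simp
  then show "x \<in> {-1..1} \<Longrightarrow> AE y in \<xi>. x \<noteq> y \<or> \<alpha> = 0" .
  have "AE y in \<xi>. 1 \<noteq> y \<or> \<alpha> = 0" "AE y in \<xi>. -1 \<noteq> y \<or> \<alpha> = 0"
    by (rule *; simp)+
  then show "AE y in \<xi>. -1 < y \<and> y < 1 \<or> \<alpha> = 0"
    using AE_space by eventually_elim (auto simp: is_designD(2)[OF d])
qed

text \<open>Each section of the diagonal is a single point, hence null when
  \<open>\<alpha> > 0\<close>. Off the diagonal the extended kernel is real and the factorization
  through \<open>riesz_root\<close> applies.\<close>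

lemma AE_off_diagonal:
  assumes "diffuse_design \<alpha> \<mu>" "diffuse_design \<alpha> \<nu>"
  shows "AE p in \<mu> \<Otimes>\<^sub>M \<nu>. fst p \<noteq> snd p \<or> \<alpha> = 0"
proof -
  have d: "is_design \<mu>" "is_design \<nu>" using assms by (auto simp: diffuse_design_def)
  interpret \<mu>: prob_space \<mu> by (rule is_designD[OF d(1)])
  interpret \<nu>: prob_space \<nu> by (rule is_designD[OF d(2)])
  interpret pair_sigma_finite \<mu> \<nu> ..
  have [measurable]: "(\<lambda>x. x) \<in> borel_measurable \<mu>" "(\<lambda>x. x) \<in> borel_measurable \<nu>"
    using d by (auto intro: is_designD)
  have "fst \<in> borel_measurable (\<mu> \<Otimes>\<^sub>M \<nu>)" "snd \<in> borel_measurable (\<mu> \<Otimes>\<^sub>M \<nu>)"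
    using measurable_compose[of fst "\<mu> \<Otimes>\<^sub>M \<nu>" \<mu> "\<lambda>x. x" borel]
      measurable_compose[of snd "\<mu> \<Otimes>\<^sub>M \<nu>" \<nu> "\<lambda>x. x" borel] by auto
  note [measurable] = this
  show ?thesis
  proof (rule AE_pair_measure)
    show "{x \<in> space (\<mu> \<Otimes>\<^sub>M \<nu>). fst x \<noteq> snd x \<or> \<alpha> = 0} \<in> sets (\<mu> \<Otimes>\<^sub>M \<nu>)" by measurable
    show "AE x in \<mu>. AE y in \<nu>. fst (x, y) \<noteq> snd (x, y) \<or> \<alpha> = 0"
    proof (rule AE_I2)
      fix x assume "x \<in> space \<mu>"
      then show "AE y in \<nu>. fst (x, y) \<noteq> snd (x, y) \<or> \<alpha> = 0"
        using diffuse_design_AE(1)[OF assms(2), of x] is_designD(2)[OF d(1)] by simp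
    qed
  qed
qed

section \<open>Bilinear energies of two designs\<close>

lemma continuous_on_design:
  fixes g :: "real \<Rightarrow> real"
  assumes g: "continuous_on UNIV g" and \<xi>: "is_design \<xi>"
  shows "\<exists>G. \<forall>u\<in>space \<xi>. \<bar>g u\<bar> \<le> G" and "g \<in> borel_measurable \<xi>" and "integrable \<xi> g"
proof -
  interpret prob_space \<xi> by (rule is_designD[OF \<xi>])
  have "bounded (g ` {-1..1})"
    by (intro compact_imp_bounded compact_continuous_image continuous_on_subset[OF g]) auto
  then obtain G where G: "\<forall>u\<in>{-1..1}. \<bar>g u\<bar> \<le> G" by (auto simp: bounded_iff)
  then show "\<exists>G. \<forall>u\<in>space \<xi>. \<bar>g u\<bar> \<le> G" using is_designD(2)[OF \<xi>] by auto
  show m: "g \<in> borel_measurable \<xi>"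
    using g by (intro is_designD(3)[OF \<xi>] borel_measurable_continuous_onI)
  show "integrable \<xi> g"
    using G is_designD(2)[OF \<xi>] m by (intro integrable_const_bound[of _ G] AE_I2) auto
qed

lemma measurable_design_pair:
  fixes g :: "real \<Rightarrow> 'a::topological_space"
  assumes "is_design \<mu>" "is_design \<nu>" "g \<in> borel_measurable borel"
  shows "(\<lambda>p. g (fst p)) \<in> borel_measurable (\<mu> \<Otimes>\<^sub>M \<nu>)" and "(\<lambda>p. g (snd p)) \<in> borel_measurable (\<mu> \<Otimes>\<^sub>M \<nu>)"
proof -
  have "sets \<mu> = sets (restrict_space borel {-1..1})" "sets \<nu> = sets (restrict_space borel {-1..1})"
    using assms by (auto simp: is_design_def)
  then have m: "g \<in> borel_measurable \<mu>" "g \<in> borel_measurable \<nu>"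
    using measurable_restrict_space1[OF assms(3), of "{-1..1}"] measurable_cong_sets[OF _ refl] by blast+
  show "(\<lambda>p. g (fst p)) \<in> borel_measurable (\<mu> \<Otimes>\<^sub>M \<nu>)" "(\<lambda>p. g (snd p)) \<in> borel_measurable (\<mu> \<Otimes>\<^sub>M \<nu>)"
    using measurable_compose[OF measurable_fst m(1)] measurable_compose[OF measurable_snd m(2)] by auto
qed

text \<open>Since \<open>riesz_kernel\<close> vanishes on the diagonal for
  \<open>\<alpha> > 0\<close>, this alone does not exclude atoms; it is meant to be combined with
  \<open>diffuse_design\<close>.\<close>

definition finite_energy :: "real \<Rightarrow> real measure \<Rightarrow> real measure \<Rightarrow> bool" where
  "finite_energy \<alpha> \<mu> \<nu> \<longleftrightarrow> integrable (\<mu> \<Otimes>\<^sub>M \<nu>) (\<lambda>p. riesz_kernel \<alpha> (fst p) (snd p))"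

text \<open>Built from \<open>real_of_ereal\<close>, as in \<open>ext_integral\<close>, so that the
  entries of \<open>B_mat\<close> are instances. Two measures are allowed because the comparison
  involves the mixed energy of two designs.\<close>

definition design_energy ::
    "real \<Rightarrow> real \<Rightarrow> real \<Rightarrow> real measure \<Rightarrow> real measure \<Rightarrow> (real \<Rightarrow> real) \<Rightarrow> (real \<Rightarrow> real) \<Rightarrow> real" where
  "design_energy \<gamma> \<beta> \<alpha> \<mu> \<nu> g h =
     (LINT p|(\<mu> \<Otimes>\<^sub>M \<nu>). real_of_ereal (power_kernel \<gamma> \<beta> \<alpha> (fst p) (snd p)) * (g (fst p) * h (snd p)))"

lemma integrable_design_product:
  fixes g h :: "real \<Rightarrow> real"
  assumes \<mu>: "is_design \<mu>" and \<nu>: "is_design \<nu>"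
    and g: "continuous_on UNIV g" and h: "continuous_on UNIV h"
  shows "finite_energy \<alpha> \<mu> \<nu> \<Longrightarrow>
      integrable (\<mu> \<Otimes>\<^sub>M \<nu>) (\<lambda>p. riesz_kernel \<alpha> (fst p) (snd p) * (g (fst p) * h (snd p)))"
    and "integrable (\<mu> \<Otimes>\<^sub>M \<nu>) (\<lambda>p. g (fst p) * h (snd p))"
    and "(LINT p|(\<mu> \<Otimes>\<^sub>M \<nu>). g (fst p) * h (snd p)) = integral\<^sup>L \<mu> g * integral\<^sup>L \<nu> h"
proof -
  interpret \<mu>: prob_space \<mu> by (rule is_designD[OF \<mu>])
  interpret \<nu>: prob_space \<nu> by (rule is_designD[OF \<nu>])
  interpret P: pair_prob_space \<mu> \<nu> ..
  obtain G H where G: "\<And>u. u \<in> space \<mu> \<Longrightarrow> \<bar>g u\<bar> \<le> G" and H: "\<And>u. u \<in> space \<nu> \<Longrightarrow> \<bar>h u\<bar> \<le> H"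
    using continuous_on_design(1)[OF g \<mu>] continuous_on_design(1)[OF h \<nu>] by blast
  have bound: "\<bar>g (fst p) * h (snd p)\<bar> \<le> G * H" if "p \<in> space (\<mu> \<Otimes>\<^sub>M \<nu>)" for p
    using that G[of "fst p"] H[of "snd p"] unfolding abs_mult
    by (intro mult_mono) (auto simp: space_pair_measure)
  have [measurable]: "(\<lambda>p. g (fst p)) \<in> borel_measurable (\<mu> \<Otimes>\<^sub>M \<nu>)" "(\<lambda>p. h (snd p)) \<in> borel_measurable (\<mu> \<Otimes>\<^sub>M \<nu>)"
    "(\<lambda>p. fst p) \<in> borel_measurable (\<mu> \<Otimes>\<^sub>M \<nu>)" "(\<lambda>p. snd p) \<in> borel_measurable (\<mu> \<Otimes>\<^sub>M \<nu>)"
    using measurable_design_pair(1)[OF \<mu> \<nu> borel_measurable_continuous_onI[OF g]]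
      measurable_design_pair(2)[OF \<mu> \<nu> borel_measurable_continuous_onI[OF h]]
      measurable_design_pair[OF \<mu> \<nu>, of "\<lambda>x. x"] by auto
  show int: "integrable (\<mu> \<Otimes>\<^sub>M \<nu>) (\<lambda>p. g (fst p) * h (snd p))"
    using bound by (intro P.integrable_const_bound[of _ "G * H"] AE_I2) auto
  show "integrable (\<mu> \<Otimes>\<^sub>M \<nu>) (\<lambda>p. riesz_kernel \<alpha> (fst p) (snd p) * (g (fst p) * h (snd p)))"
    if "finite_energy \<alpha> \<mu> \<nu>"
  proof (rule Bochner_Integration.integrable_bound)
    show "integrable (\<mu> \<Otimes>\<^sub>M \<nu>) (\<lambda>p. riesz_kernel \<alpha> (fst p) (snd p) * (G * H))"
      using that unfolding finite_energy_def by (rule integrable_mult_left)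
    show "AE p in \<mu> \<Otimes>\<^sub>M \<nu>. norm (riesz_kernel \<alpha> (fst p) (snd p) * (g (fst p) * h (snd p)))
        \<le> norm (riesz_kernel \<alpha> (fst p) (snd p) * (G * H))"
    proof (rule AE_I2)
      fix p assume "p \<in> space (\<mu> \<Otimes>\<^sub>M \<nu>)"
      from order_trans[OF bound[OF this] abs_ge_self]
      show "norm (riesz_kernel \<alpha> (fst p) (snd p) * (g (fst p) * h (snd p)))
        \<le> norm (riesz_kernel \<alpha> (fst p) (snd p) * (G * H))"
        unfolding norm_mult real_norm_def abs_mult[symmetric]
        by (simp only: abs_mult[of "riesz_kernel _ _ _"]) (intro mult_left_mono, auto)
    qed
  qed measurable
  show "(LINT p|(\<mu> \<Otimes>\<^sub>M \<nu>). g (fst p) * h (snd p)) = integral\<^sup>L \<mu> g * integral\<^sup>L \<nu> h"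
    using P.integral_fst'[OF int] by simp
qed

lemma borel_measurable_power_kernel [measurable (raw)]:
  assumes [measurable]: "f \<in> borel_measurable M" "g \<in> borel_measurable M"
  shows "(\<lambda>x. power_kernel \<gamma> \<beta> \<alpha> (f x) (g x)) \<in> borel_measurable M"
  unfolding power_kernel_def by measurable

text \<open>The constant part of the kernel has rank one and yields a product of means; the singular
  part is a Riesz energy. The kernels are compared off the diagonal, that is almost
  everywhere.\<close>

lemma design_energy_split:
  fixes g h :: "real \<Rightarrow> real"
  assumes \<mu>: "diffuse_design \<alpha> \<mu>" and \<nu>: "diffuse_design \<alpha> \<nu>" and fin: "finite_energy \<alpha> \<mu> \<nu>"
    and g: "continuous_on UNIV g" and h: "continuous_on UNIV h"
  shows "integrable (\<mu> \<Otimes>\<^sub>M \<nu>) (\<lambda>p. real_of_ereal (power_kernel \<gamma> \<beta> \<alpha> (fst p) (snd p)) * (g (fst p) * h (snd p)))"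
    and "design_energy \<gamma> \<beta> \<alpha> \<mu> \<nu> g h = \<gamma> * (integral\<^sup>L \<mu> g * integral\<^sup>L \<nu> h)
      + \<beta> * (LINT p|(\<mu> \<Otimes>\<^sub>M \<nu>). riesz_kernel \<alpha> (fst p) (snd p) * (g (fst p) * h (snd p)))"
proof -
  have d: "is_design \<mu>" "is_design \<nu>" using \<mu> \<nu> by (auto simp: diffuse_design_def)
  note prod = integrable_design_product[OF d g h]
  let ?R = "\<lambda>p. real_of_ereal (power_kernel \<gamma> \<beta> \<alpha> (fst p) (snd p)) * (g (fst p) * h (snd p))"
  let ?S = "\<lambda>p. \<gamma> * (g (fst p) * h (snd p)) + \<beta> * (riesz_kernel \<alpha> (fst p) (snd p) * (g (fst p) * h (snd p)))"
  have AE: "AE p in \<mu> \<Otimes>\<^sub>M \<nu>. ?S p = ?R p"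
    using AE_off_diagonal[OF \<mu> \<nu>]
    by eventually_elim (auto simp: power_kernel_eq_riesz algebra_simps)
  have m: "?R \<in> borel_measurable (\<mu> \<Otimes>\<^sub>M \<nu>)"
    using measurable_design_pair[OF d borel_measurable_continuous_onI[OF g]]
      measurable_design_pair[OF d borel_measurable_continuous_onI[OF h]]
      measurable_design_pair[OF d, of "\<lambda>x. x"]
    by (intro borel_measurable_times borel_measurable_real_of_ereal borel_measurable_power_kernel) auto
  have S: "integrable (\<mu> \<Otimes>\<^sub>M \<nu>) ?S"
    using prod(1)[OF fin] prod(2) by (intro Bochner_Integration.integrable_add integrable_mult_right)
  show R: "integrable (\<mu> \<Otimes>\<^sub>M \<nu>) ?R"
    by (rule integrable_cong_AE_imp[OF S m]) (use AE in \<open>auto elim: eventually_mono\<close>)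
  have "design_energy \<gamma> \<beta> \<alpha> \<mu> \<nu> g h = integral\<^sup>L (\<mu> \<Otimes>\<^sub>M \<nu>) ?S"
    unfolding design_energy_def using S m AE
    by (intro integral_cong_AE) (auto elim: eventually_mono)
  also have "\<dots> = \<gamma> * (integral\<^sup>L \<mu> g * integral\<^sup>L \<nu> h)
      + \<beta> * (LINT p|(\<mu> \<Otimes>\<^sub>M \<nu>). riesz_kernel \<alpha> (fst p) (snd p) * (g (fst p) * h (snd p)))"
    using prod(1)[OF fin] prod(2,3)
    by (subst Bochner_Integration.integral_add) (auto intro: integrable_mult_right)
  finally show "design_energy \<gamma> \<beta> \<alpha> \<mu> \<nu> g h = \<gamma> * (integral\<^sup>L \<mu> g * integral\<^sup>L \<nu> h)
      + \<beta> * (LINT p|(\<mu> \<Otimes>\<^sub>M \<nu>). riesz_kernel \<alpha> (fst p) (snd p) * (g (fst p) * h (snd p)))" .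
qed

text \<open>The constant part contributes \<gamma> times the square of the difference of the two
  means, the singular part is nonnegative by positive type.\<close>

lemma design_energy_nonneg:
  fixes g h :: "real \<Rightarrow> real"
  assumes \<alpha>: "0 \<le> \<alpha>" "\<alpha> < 1" and "0 \<le> \<gamma>" "0 \<le> \<beta>"
    and \<mu>: "diffuse_design \<alpha> \<mu>" and \<nu>: "diffuse_design \<alpha> \<nu>"
    and fin: "finite_energy \<alpha> \<mu> \<mu>" "finite_energy \<alpha> \<mu> \<nu>" "finite_energy \<alpha> \<nu> \<nu>"
    and g: "continuous_on UNIV g" and h: "continuous_on UNIV h"
  shows "0 \<le> design_energy \<gamma> \<beta> \<alpha> \<mu> \<mu> g g - 2 * design_energy \<gamma> \<beta> \<alpha> \<mu> \<nu> g h + design_energy \<gamma> \<beta> \<alpha> \<nu> \<nu> h h"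
proof -
  have d: "is_design \<mu>" "is_design \<nu>" using \<mu> \<nu> by (auto simp: diffuse_design_def)
  obtain G H where G: "\<And>u. u \<in> space \<mu> \<Longrightarrow> \<bar>g u\<bar> \<le> G" and H: "\<And>u. u \<in> space \<nu> \<Longrightarrow> \<bar>h u\<bar> \<le> H"
    using continuous_on_design(1)[OF g d(1)] continuous_on_design(1)[OF h d(2)] by blast
  have id: "(\<lambda>x. x) \<in> borel_measurable \<mu>" "(\<lambda>x. x) \<in> borel_measurable \<nu>"
    using d by (auto intro: is_designD(3))
  define A where "A = (LINT p|(\<mu> \<Otimes>\<^sub>M \<mu>). riesz_kernel \<alpha> (fst p) (snd p) * (g (fst p) * g (snd p)))"
  define B where "B = (LINT p|(\<mu> \<Otimes>\<^sub>M \<nu>). riesz_kernel \<alpha> (fst p) (snd p) * (g (fst p) * h (snd p)))"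
  define C where "C = (LINT p|(\<nu> \<Otimes>\<^sub>M \<nu>). riesz_kernel \<alpha> (fst p) (snd p) * (h (fst p) * h (snd p)))"
  have "0 \<le> A - 2 * B + C"
    unfolding A_def B_def C_def
    using G H
    by (rule riesz_energy_nonneg[OF \<alpha> is_designD(4)[OF d(1)] id(1) is_designD(4)[OF d(2)] id(2)
        fin[unfolded finite_energy_def] AE_off_diagonal[OF \<mu> \<mu>] AE_off_diagonal[OF \<mu> \<nu>]
        AE_off_diagonal[OF \<nu> \<nu>] continuous_on_design(2)[OF g d(1)] continuous_on_design(2)[OF h d(2)]])
  then have "0 \<le> \<gamma> * (integral\<^sup>L \<mu> g - integral\<^sup>L \<nu> h)\<^sup>2 + \<beta> * (A - 2 * B + C)"
    using assms by simp
  also have "\<dots> = design_energy \<gamma> \<beta> \<alpha> \<mu> \<mu> g g - 2 * design_energy \<gamma> \<beta> \<alpha> \<mu> \<nu> g h + design_energy \<gamma> \<beta> \<alpha> \<nu> \<nu> h h"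
    unfolding design_energy_split(2)[OF \<mu> \<mu> fin(1) g g] design_energy_split(2)[OF \<mu> \<nu> fin(2) g h]
      design_energy_split(2)[OF \<nu> \<nu> fin(3) h h] A_def[symmetric] B_def[symmetric] C_def[symmetric]
    by (simp add: power2_eq_square algebra_simps)
  finally show ?thesis .
qed

section \<open>Mixed energies with the arcsine design\<close>

lemma arcsine_potential_monomial:
  fixes u \<alpha> :: real
  assumes \<alpha>: "0 \<le> \<alpha>" "\<alpha> < 1" and u: "-1 < u \<and> u < 1 \<or> \<alpha> = 0"
  shows "integrable (arcsine_design \<alpha>) (\<lambda>v. riesz_kernel \<alpha> u v * v ^ k)"
    and "\<alpha> \<noteq> 0 \<Longrightarrow> (LINT v|arcsine_design \<alpha>. riesz_kernel \<alpha> u v * v ^ k) = arcsine_const \<alpha> * arcsine_moment \<alpha> k u"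
proof -
  have eq: "arcsine_weight \<alpha> v * (riesz_kernel \<alpha> u v * v ^ k) = arcsine_weight \<alpha> v * v ^ k * \<bar>v - u\<bar> powr (-\<alpha>)"
    if "\<alpha> \<noteq> 0" for v using that by (simp add: riesz_kernel_def abs_minus_commute)
  show "integrable (arcsine_design \<alpha>) (\<lambda>v. riesz_kernel \<alpha> u v * v ^ k)"
  proof (cases "\<alpha> = 0")
    case True
    then show ?thesis
      using continuous_on_design(3)[OF _ is_design_arcsine[OF \<alpha>], of "\<lambda>v. v ^ k"]
      by (simp add: riesz_kernel_def continuous_on_power)
  next
    case False
    with u integrable_arcsine_potential(2)[OF \<alpha>, of u k] show ?thesis
      by (simp add: arcsine_design_integral(1)[OF \<alpha>] eq)
  qed
  show "(LINT v|arcsine_design \<alpha>. riesz_kernel \<alpha> u v * v ^ k) = arcsine_const \<alpha> * arcsine_moment \<alpha> k u"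
    if "\<alpha> \<noteq> 0"
    using that by (simp add: arcsine_design_integral(2)[OF \<alpha>] eq arcsine_moment_def)
qed

lemma arcsine_potential_polynomial:
  fixes b :: "nat \<Rightarrow> real"
  assumes \<alpha>: "0 \<le> \<alpha>" "\<alpha> < 1" and m: "1 \<le> m"
  shows "\<exists>c. \<forall>u. -1 < u \<and> u < 1 \<or> \<alpha> = 0 \<longrightarrow>
    (LINT v|arcsine_design \<alpha>. riesz_kernel \<alpha> u v * (\<Sum>i<m. b i * v ^ i)) = (\<Sum>j<m. c j * u ^ j)"
proof -
  let ?I = "\<lambda>u k. LINT v|arcsine_design \<alpha>. riesz_kernel \<alpha> u v * v ^ k"
  have ex: "\<exists>c. \<forall>u. -1 < u \<and> u < 1 \<or> \<alpha> = 0 \<longrightarrow> ?I u k = (\<Sum>j<m. c j * u ^ j)" if k: "k < m" for k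
  proof (cases "\<alpha> = 0")
    case True
    \<comment> \<open>The kernel is 1, so the potential is constant at every \<open>u\<close>,
      endpoints included; \<open>1 \<le> m\<close> provides the coefficient of degree 0.\<close>
    then have *: "?I u k = (\<Sum>j<m. (if j = 0 then LINT v|arcsine_design \<alpha>. v ^ k else 0) * u ^ j)" for u
      using m by (simp add: riesz_kernel_def if_distrib[of "\<lambda>x. x * _"] sum.delta' cong: if_cong)
    show ?thesis by (intro exI allI impI) (rule *)
  next
    case False
    obtain c where c: "\<And>v. -1 < v \<Longrightarrow> v < 1 \<Longrightarrow> arcsine_moment \<alpha> k v = (\<Sum>j\<le>k. c j * v ^ j)"
      using arcsine_moment_polynomial[OF \<alpha>, of k] by blast
    have *: "?I u k = (\<Sum>j<m. (if j \<le> k then arcsine_const \<alpha> * c j else 0) * u ^ j)" if u: "-1 < u" "u < 1" for u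
    proof -
      have "?I u k = (\<Sum>j\<le>k. arcsine_const \<alpha> * c j * u ^ j)"
        using arcsine_potential_monomial(2)[OF \<alpha> _ False, of u k] u
        by (simp add: c sum_distrib_left mult.assoc)
      also have "\<dots> = (\<Sum>j<m. (if j \<le> k then arcsine_const \<alpha> * c j else 0) * u ^ j)"
        using k by (intro sum.mono_neutral_cong_left) auto
      finally show ?thesis .
    qed
    show ?thesis by (intro exI allI impI, rule *) (use False in auto)
  qed
  have "\<forall>k\<in>{..<m}. \<exists>c. \<forall>u. -1 < u \<and> u < 1 \<or> \<alpha> = 0 \<longrightarrow> ?I u k = (\<Sum>j<m. c j * u ^ j)"
    by (rule ballI, rule ex) simp
  from bchoice[OF this] obtain c where
    c': "\<forall>k\<in>{..<m}. \<forall>u. -1 < u \<and> u < 1 \<or> \<alpha> = 0 \<longrightarrow> ?I u k = (\<Sum>j<m. c k j * u ^ j)"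
    by (rule exE)
  have c: "?I u k = (\<Sum>j<m. c k j * u ^ j)" if "k < m" "-1 < u \<and> u < 1 \<or> \<alpha> = 0" for k u
    using that by (intro c'[rule_format]) auto
  have *: "(LINT v|arcsine_design \<alpha>. riesz_kernel \<alpha> u v * (\<Sum>i<m. b i * v ^ i)) = (\<Sum>j<m. (\<Sum>i<m. b i * c i j) * u ^ j)"
    if u: "-1 < u \<and> u < 1 \<or> \<alpha> = 0" for u
  proof -
    have "(LINT v|arcsine_design \<alpha>. riesz_kernel \<alpha> u v * (\<Sum>i<m. b i * v ^ i))
        = (LINT v|arcsine_design \<alpha>. (\<Sum>i<m. b i * (riesz_kernel \<alpha> u v * v ^ i)))"
      by (simp add: sum_distrib_left mult_ac)
    also have "\<dots> = (\<Sum>i<m. b i * ?I u i)"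
      by (subst Bochner_Integration.integral_sum)
         (auto intro!: integrable_mult_right arcsine_potential_monomial(1)[OF \<alpha> u])
    also have "\<dots> = (\<Sum>i<m. \<Sum>j<m. b i * (c i j * u ^ j))"
      using u by (intro sum.cong refl) (simp add: c sum_distrib_left)
    also have "\<dots> = (\<Sum>j<m. (\<Sum>i<m. b i * c i j) * u ^ j)"
      by (subst sum.swap) (simp add: sum_distrib_right mult.assoc)
    finally show ?thesis .
  qed
  show ?thesis by (intro exI allI impI) (rule *)
qed

text \<open>The inner integral is the potential of the arcsine design, which is almost everywhere
  one constant, so it is integrable against any probability measure. The energy of the arcsine
  design with itself is included.\<close>

lemma finite_energy_arcsine:
  assumes \<alpha>: "0 \<le> \<alpha>" "\<alpha> < 1" and \<mu>: "diffuse_design \<alpha> \<mu>"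
  shows "finite_energy \<alpha> \<mu> (arcsine_design \<alpha>)"
proof -
  let ?\<nu> = "arcsine_design \<alpha>"
  have d: "is_design \<mu>" using \<mu> by (simp add: diffuse_design_def)
  note d' = is_design_arcsine[OF \<alpha>]
  interpret \<mu>: prob_space \<mu> by (rule is_designD[OF d])
  interpret \<nu>: prob_space ?\<nu> by (rule is_designD[OF d'])
  interpret pair_sigma_finite \<mu> ?\<nu> ..
  \<comment> \<open>The polynomial lemma with m = 1 leaves only a term of degree 0.\<close>
  obtain c where c: "\<And>u. -1 < u \<and> u < 1 \<or> \<alpha> = 0 \<Longrightarrow> (LINT v|?\<nu>. riesz_kernel \<alpha> u v) = c"
    using arcsine_potential_polynomial[OF \<alpha> order_refl, of "\<lambda>_. 1"] by auto
  have m: "(\<lambda>p. riesz_kernel \<alpha> (fst p) (snd p)) \<in> borel_measurable (\<mu> \<Otimes>\<^sub>M ?\<nu>)"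
    using measurable_design_pair[OF d d', of "\<lambda>x. x"] by (intro borel_measurable_riesz_kernel) auto
  show ?thesis
    unfolding finite_energy_def
  proof (rule Fubini_integrable[OF m])
    show "integrable \<mu> (\<lambda>x. LINT y|?\<nu>. norm (riesz_kernel \<alpha> (fst (x, y)) (snd (x, y))))"
    proof (rule integrable_cong_AE_imp)
      show "integrable \<mu> (\<lambda>_. c)" by simp
      show "AE u in \<mu>. c = (LINT v|?\<nu>. norm (riesz_kernel \<alpha> (fst (u, v)) (snd (u, v))))"
        using diffuse_design_AE(2)[OF \<mu>] by eventually_elim (simp add: c)
      show "(\<lambda>x. LINT y|?\<nu>. norm (riesz_kernel \<alpha> (fst (x, y)) (snd (x, y)))) \<in> borel_measurable \<mu>"
        using m by (intro \<nu>.borel_measurable_lebesgue_integral) (simp add: case_prod_unfold)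
    qed
    show "AE u in \<mu>. integrable ?\<nu> (\<lambda>v. riesz_kernel \<alpha> (fst (u, v)) (snd (u, v)))"
      using diffuse_design_AE(2)[OF \<mu>]
    proof eventually_elim
      case (elim u)
      from arcsine_potential_monomial(1)[OF \<alpha> elim, of 0] show ?case by simp
    qed
  qed
qed

text \<open>The order of quantifiers is the point: the coefficients \<open>c\<close> depend on
  \<open>b\<close> but not on the design \<open>\<mu>\<close> or the function \<open>g\<close>, so
  one choice serves an arbitrary design and the arcsine design alike. It results from integrating
  the polynomial potential against g \<mu>.\<close>

lemma design_energy_arcsine:
  fixes b :: "nat \<Rightarrow> real"
  assumes \<alpha>: "0 \<le> \<alpha>" "\<alpha> < 1" and m: "1 \<le> m"
  shows "\<exists>c. \<forall>\<mu> g. diffuse_design \<alpha> \<mu> \<longrightarrow> continuous_on UNIV g \<longrightarrow>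
    design_energy \<gamma> \<beta> \<alpha> \<mu> (arcsine_design \<alpha>) g (\<lambda>v. \<Sum>i<m. b i * v ^ i) = (\<Sum>j<m. c j * (LINT u|\<mu>. g u * u ^ j))"
proof -
  let ?\<nu> = "arcsine_design \<alpha>"
  define h where "h = (\<lambda>v. \<Sum>i<m. b i * v ^ i)"
  obtain c where c': "\<forall>u. -1 < u \<and> u < 1 \<or> \<alpha> = 0 \<longrightarrow>
      (LINT v|?\<nu>. riesz_kernel \<alpha> u v * (\<Sum>i<m. b i * v ^ i)) = (\<Sum>j<m. c j * u ^ j)"
    using arcsine_potential_polynomial[OF \<alpha> m, of b] by (rule exE)
  have c: "(LINT v|?\<nu>. riesz_kernel \<alpha> u v * h v) = (\<Sum>j<m. c j * u ^ j)"
    if "-1 < u \<and> u < 1 \<or> \<alpha> = 0" for u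
    unfolding h_def by (rule c'[rule_format, OF that])
  \<comment> \<open>The constant part of the kernel sees \<open>g\<close> only through its mean, the
    moment of order 0; its contribution is placed in that coefficient.\<close>
  have *: "design_energy \<gamma> \<beta> \<alpha> \<mu> ?\<nu> g h
      = (\<Sum>j<m. ((if j = 0 then \<gamma> * integral\<^sup>L ?\<nu> h else 0) + \<beta> * c j) * (LINT u|\<mu>. g u * u ^ j))"
    if \<mu>: "diffuse_design \<alpha> \<mu>" and g: "continuous_on UNIV g" for \<mu> g
  proof -
    have d: "is_design \<mu>" using \<mu> by (simp add: diffuse_design_def)
    note d' = is_design_arcsine[OF \<alpha>] and fin = finite_energy_arcsine[OF \<alpha> \<mu>]
    have h: "continuous_on UNIV h" unfolding h_def by (intro continuous_intros)
    interpret \<mu>: prob_space \<mu> by (rule is_designD[OF d])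
    interpret \<nu>: prob_space ?\<nu> by (rule is_designD[OF d'])
    interpret pair_sigma_finite \<mu> ?\<nu> ..
    note int = integrable_design_product(1)[OF d d' g h fin]
    have eq: "(LINT v|?\<nu>. riesz_kernel \<alpha> u v * (g u * h v)) = g u * (LINT v|?\<nu>. riesz_kernel \<alpha> u v * h v)" for u
    proof -
      have "riesz_kernel \<alpha> u v * (g u * h v) = g u * (riesz_kernel \<alpha> u v * h v)" for v
        by (rule mult.left_commute)
      then show ?thesis by (simp only: integral_mult_right_zero)
    qed
    have "(LINT p|(\<mu> \<Otimes>\<^sub>M ?\<nu>). riesz_kernel \<alpha> (fst p) (snd p) * (g (fst p) * h (snd p)))
        = (LINT u|\<mu>. g u * (LINT v|?\<nu>. riesz_kernel \<alpha> u v * h v))"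
      using integral_fst'[OF int] by (simp only: eq fst_conv snd_conv)
    also have "\<dots> = (LINT u|\<mu>. (\<Sum>j<m. c j * (g u * u ^ j)))"
    proof (rule integral_cong_AE)
      show "AE u in \<mu>. g u * (LINT v|?\<nu>. riesz_kernel \<alpha> u v * h v) = (\<Sum>j<m. c j * (g u * u ^ j))"
        using diffuse_design_AE(2)[OF \<mu>]
      proof eventually_elim
        case (elim u)
        show ?case unfolding c[OF elim] sum_distrib_left by (intro sum.cong refl mult.left_commute)
      qed
      show "(\<lambda>u. g u * (LINT v|?\<nu>. riesz_kernel \<alpha> u v * h v)) \<in> borel_measurable \<mu>"
        using borel_measurable_integrable[OF integrable_fst'[OF int]] by (simp only: eq fst_conv snd_conv)
      show "(\<lambda>u. \<Sum>j<m. c j * (g u * u ^ j)) \<in> borel_measurable \<mu>"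
        by (intro continuous_on_design(2)[OF _ d] continuous_intros g)
    qed
    also have "\<dots> = (\<Sum>j<m. c j * (LINT u|\<mu>. g u * u ^ j))"
      by (subst Bochner_Integration.integral_sum)
         (auto intro!: integrable_mult_right continuous_on_design(3)[OF _ d] continuous_intros g)
    finally have "design_energy \<gamma> \<beta> \<alpha> \<mu> ?\<nu> g h
        = \<gamma> * (integral\<^sup>L \<mu> g * integral\<^sup>L ?\<nu> h) + \<beta> * (\<Sum>j<m. c j * (LINT u|\<mu>. g u * u ^ j))"
      unfolding design_energy_split(2)[OF \<mu> diffuse_design_arcsine[OF \<alpha>] fin g h] by simp
    also have "\<gamma> * (integral\<^sup>L \<mu> g * integral\<^sup>L ?\<nu> h)
        = (\<Sum>j<m. (if j = 0 then \<gamma> * integral\<^sup>L ?\<nu> h else 0) * (LINT u|\<mu>. g u * u ^ j))"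
      using m by (simp add: if_distrib[of "\<lambda>x. x * _"] cong: if_cong)
    finally show ?thesis by (simp add: distrib_right sum.distrib sum_distrib_left mult.assoc)
  qed
  show ?thesis unfolding h_def[symmetric] by (intro exI allI impI) (rule *)
qed

section \<open>Admissibility and finite energy\<close>

lemma measurable_design_power_kernel:
  assumes "is_design \<mu>" "is_design \<nu>"
  shows "(\<lambda>p. power_kernel \<gamma> \<beta> \<alpha> (fst p) (snd p)) \<in> borel_measurable (\<mu> \<Otimes>\<^sub>M \<nu>)"
  using measurable_design_pair[OF assms, of "\<lambda>x. x"] by (intro borel_measurable_power_kernel) auto

lemma B_integrand_poly_regressors:
  assumes "i < m" "j < m"
  shows "B_integrand (poly_regressors m) K i j = (\<lambda>p. K (fst p) (snd p) * ereal (fst p ^ i * snd p ^ j))"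
  using assms by (simp add: B_integrand_def poly_regressors_def case_prod_unfold)

lemma B_well_defined_finite_energy:
  assumes \<mu>: "diffuse_design \<alpha> \<mu>" and fin: "finite_energy \<alpha> \<mu> \<mu>"
  shows "B_well_defined m (poly_regressors m) (power_kernel \<gamma> \<beta> \<alpha>) \<mu>"
  unfolding B_well_defined_def
proof (intro allI impI)
  fix i j assume ij: "i < m" "j < m"
  have d: "is_design \<mu>" using \<mu> by (simp add: diffuse_design_def)
  let ?R = "\<lambda>p. real_of_ereal (power_kernel \<gamma> \<beta> \<alpha> (fst p) (snd p)) * (fst p ^ i * snd p ^ j)"
  have cont: "continuous_on UNIV (\<lambda>u::real. u ^ k)" for k by (intro continuous_intros)
  have R: "integrable (\<mu> \<Otimes>\<^sub>M \<mu>) ?R"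
    by (rule design_energy_split(1)[OF \<mu> \<mu> fin cont cont])
  have "(\<integral>\<^sup>+p. e2ennreal \<bar>power_kernel \<gamma> \<beta> \<alpha> (fst p) (snd p) * ereal (fst p ^ i * snd p ^ j)\<bar> \<partial>(\<mu> \<Otimes>\<^sub>M \<mu>))
      = (\<integral>\<^sup>+p. ennreal (norm (?R p)) \<partial>(\<mu> \<Otimes>\<^sub>M \<mu>))"
  proof (rule nn_integral_cong_AE)
    show "AE p in \<mu> \<Otimes>\<^sub>M \<mu>. e2ennreal \<bar>power_kernel \<gamma> \<beta> \<alpha> (fst p) (snd p) * ereal (fst p ^ i * snd p ^ j)\<bar>
        = ennreal (norm (?R p))"
      using AE_off_diagonal[OF \<mu> \<mu>]
      by eventually_elim (simp add: power_kernel_eq_riesz e2ennreal_ereal)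
  qed
  also have "\<dots> < \<infinity>" using R by (simp add: integrable_iff_bounded)
  finally have "(\<integral>\<^sup>+p. e2ennreal \<bar>power_kernel \<gamma> \<beta> \<alpha> (fst p) (snd p) * ereal (fst p ^ i * snd p ^ j)\<bar> \<partial>(\<mu> \<Otimes>\<^sub>M \<mu>)) < \<infinity>" .
  moreover have "(\<lambda>p. power_kernel \<gamma> \<beta> \<alpha> (fst p) (snd p) * ereal (fst p ^ i * snd p ^ j)) \<in> borel_measurable (\<mu> \<Otimes>\<^sub>M \<mu>)"
    using measurable_design_pair[OF d d, of "\<lambda>x. x"]
    by (intro borel_measurable_ereal_times measurable_design_power_kernel[OF d d] borel_measurable_ereal
        borel_measurable_times borel_measurable_power) auto
  ultimately show "ext_integrable (\<mu> \<Otimes>\<^sub>M \<mu>) (B_integrand (poly_regressors m) (power_kernel \<gamma> \<beta> \<alpha>) i j)"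
    by (simp add: ext_integrable_def B_integrand_poly_regressors[OF ij])
qed

text \<open>As the first regression function is 1, the entry (0, 0) of the matrix is the energy of
  \<open>\<xi>\<close> itself. For \<open>\<alpha> > 0\<close> an atom would make it infinite, and
  \<open>riesz_kernel\<close> is at most the full kernel divided by \<beta>.\<close>

lemma admissible_finite_energy:
  assumes m: "1 \<le> m" and "0 \<le> \<gamma>" "0 < \<beta>"
    and \<xi>: "is_design \<xi>" and B: "B_well_defined m (poly_regressors m) (power_kernel \<gamma> \<beta> \<alpha>) \<xi>"
  shows "diffuse_design \<alpha> \<xi>" and "finite_energy \<alpha> \<xi> \<xi>"
proof -
  interpret prob_space \<xi> by (rule is_designD[OF \<xi>])
  let ?N = "\<lambda>p. e2ennreal \<bar>power_kernel \<gamma> \<beta> \<alpha> (fst p) (snd p)\<bar>"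
  have "ext_integrable (\<xi> \<Otimes>\<^sub>M \<xi>) (B_integrand (poly_regressors m) (power_kernel \<gamma> \<beta> \<alpha>) 0 0)"
    using B m unfolding B_well_defined_def by simp
  then have N: "(\<integral>\<^sup>+p. ?N p \<partial>(\<xi> \<Otimes>\<^sub>M \<xi>)) < \<infinity>"
    using m by (simp add: ext_integrable_def B_integrand_poly_regressors one_ereal_def[symmetric])
  have mN: "?N \<in> borel_measurable (\<xi> \<Otimes>\<^sub>M \<xi>)"
    using measurable_design_power_kernel[OF \<xi> \<xi>] by measurable
  have "emeasure \<xi> {x} = 0" if "\<alpha> \<noteq> 0" "x \<in> {-1..1}" for x
  proof -
    have x: "{x} \<in> sets \<xi>" using \<xi> that by (auto simp: is_design_def sets_restrict_space_iff)
    \<comment> \<open>The point (x, x) alone contributes infinity times its mass; finiteness forces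
      the mass to be 0.\<close>
    have "\<infinity> * (emeasure \<xi> {x} * emeasure \<xi> {x}) = \<infinity> * emeasure (\<xi> \<Otimes>\<^sub>M \<xi>) ({x} \<times> {x})"
      by (simp only: emeasure_pair_measure_Times[OF x x])
    also have "\<dots> = (\<integral>\<^sup>+p. \<infinity> * indicator ({x} \<times> {x}) p \<partial>(\<xi> \<Otimes>\<^sub>M \<xi>))"
      by (rule nn_integral_cmult_indicator[OF pair_measureI[OF x x], symmetric])
    also have "\<dots> \<le> (\<integral>\<^sup>+p. ?N p \<partial>(\<xi> \<Otimes>\<^sub>M \<xi>))"
      using that by (intro nn_integral_mono) (auto simp: power_kernel_def indicator_def)
    also note N
    finally show ?thesis by (auto simp: ennreal_top_mult split: if_splits)
  qed
  then show d: "diffuse_design \<alpha> \<xi>" using \<xi> by (auto simp: diffuse_design_def)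
  show "finite_energy \<alpha> \<xi> \<xi>"
    unfolding finite_energy_def
  proof (rule integrableI_bounded)
    show "(\<lambda>p. riesz_kernel \<alpha> (fst p) (snd p)) \<in> borel_measurable (\<xi> \<Otimes>\<^sub>M \<xi>)"
      using measurable_design_pair[OF \<xi> \<xi>, of "\<lambda>x. x"] by (intro borel_measurable_riesz_kernel) auto
    have "(\<integral>\<^sup>+p. ennreal (norm (riesz_kernel \<alpha> (fst p) (snd p))) \<partial>(\<xi> \<Otimes>\<^sub>M \<xi>))
        \<le> (\<integral>\<^sup>+p. ennreal (1 / \<beta>) * ?N p \<partial>(\<xi> \<Otimes>\<^sub>M \<xi>))"
    proof (rule nn_integral_mono_AE)
      show "AE p in \<xi> \<Otimes>\<^sub>M \<xi>. ennreal (norm (riesz_kernel \<alpha> (fst p) (snd p))) \<le> ennreal (1 / \<beta>) * ?N p"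
        using AE_off_diagonal[OF d d]
      proof eventually_elim
        case (elim p)
        have "riesz_kernel \<alpha> (fst p) (snd p) \<le> 1 / \<beta> * \<bar>\<gamma> + \<beta> * riesz_kernel \<alpha> (fst p) (snd p)\<bar>"
          using assms by (simp add: field_simps)
        then have "ennreal (riesz_kernel \<alpha> (fst p) (snd p))
            \<le> ennreal (1 / \<beta> * \<bar>\<gamma> + \<beta> * riesz_kernel \<alpha> (fst p) (snd p)\<bar>)"
          by (rule ennreal_leI)
        also have "\<dots> = ennreal (1 / \<beta>) * ennreal \<bar>\<gamma> + \<beta> * riesz_kernel \<alpha> (fst p) (snd p)\<bar>"
          by (rule ennreal_mult'') simp
        also have "ennreal \<bar>\<gamma> + \<beta> * riesz_kernel \<alpha> (fst p) (snd p)\<bar> = ?N p"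
          unfolding power_kernel_eq_riesz[OF elim] by (simp only: abs_ereal.simps e2ennreal_ereal)
        finally show ?case by simp
      qed
    qed
    also have "\<dots> = ennreal (1 / \<beta>) * (\<integral>\<^sup>+p. ?N p \<partial>(\<xi> \<Otimes>\<^sub>M \<xi>))"
      by (rule nn_integral_cmult[OF mN])
    also have "\<dots> < \<infinity>" using N by (simp add: ennreal_mult_less_top)
    finally show "(\<integral>\<^sup>+p. ennreal (norm (riesz_kernel \<alpha> (fst p) (snd p))) \<partial>(\<xi> \<Otimes>\<^sub>M \<xi>)) < \<infinity>" .
  qed
qed

section \<open>Information matrices\<close>

definition vec_poly :: "real vec \<Rightarrow> real \<Rightarrow> real" where
  "vec_poly a u = (\<Sum>i<dim_vec a. a $ i * u ^ i)"

lemma continuous_on_vec_poly: "continuous_on UNIV (vec_poly a)"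
  unfolding vec_poly_def by (intro continuous_intros)

lemma M_mat_carrier [simp]: "M_mat m f \<xi> \<in> carrier_mat m m"
  by (simp add: M_mat_def)

lemma B_mat_carrier [simp]: "B_mat m f K \<xi> \<in> carrier_mat m m"
  by (simp add: B_mat_def)

lemma transpose_M_mat [simp]: "transpose_mat (M_mat m f \<xi>) = M_mat m f \<xi>"
  by (intro eq_matI) (auto simp: M_mat_def mult.commute)

text \<open>Translates a linear system for the coefficients \<open>a\<close> into prescribed moments
  of the polynomial times the design.\<close>

lemma M_mat_mult_vec:
  assumes \<xi>: "is_design \<xi>" and a: "a \<in> carrier_vec m" and j: "j < m"
  shows "(M_mat m (poly_regressors m) \<xi> *\<^sub>v a) $ j = (LINT u|\<xi>. vec_poly a u * u ^ j)"
proof -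
  have "(M_mat m (poly_regressors m) \<xi> *\<^sub>v a) $ j = (\<Sum>i<m. (LINT u|\<xi>. u ^ j * u ^ i) * a $ i)"
    using a j by (simp add: M_mat_def scalar_prod_def poly_regressors_def atLeast0LessThan)
  also have "\<dots> = (\<Sum>i<m. LINT u|\<xi>. u ^ j * u ^ i * a $ i)" by simp
  also have "\<dots> = (LINT u|\<xi>. (\<Sum>i<m. u ^ j * u ^ i * a $ i))"
    by (intro Bochner_Integration.integral_sum[symmetric] continuous_on_design(3)[OF _ \<xi>] continuous_intros)
  also have "\<dots> = (LINT u|\<xi>. vec_poly a u * u ^ j)"
    using a by (intro Bochner_Integration.integral_cong refl) (simp add: vec_poly_def sum_distrib_left mult_ac)
  finally show ?thesis .
qed

lemma B_mat_entry:
  assumes "i < m" "j < m"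
  shows "B_mat m (poly_regressors m) (power_kernel \<gamma> \<beta> \<alpha>) \<xi> $$ (i, j)
    = design_energy \<gamma> \<beta> \<alpha> \<xi> \<xi> (\<lambda>u. u ^ i) (\<lambda>v. v ^ j)"
  using assms by (simp add: B_mat_def ext_integral_def B_integrand_poly_regressors design_energy_def)

text \<open>Bilinearity of the energy; \<open>finite_energy\<close> makes every monomial term
  integrable, so the double sum may leave the integral.\<close>

lemma B_mat_quadratic_form:
  assumes \<xi>: "diffuse_design \<alpha> \<xi>" and fin: "finite_energy \<alpha> \<xi> \<xi>" and a: "a \<in> carrier_vec m"
  shows "scalar_prod a (B_mat m (poly_regressors m) (power_kernel \<gamma> \<beta> \<alpha>) \<xi> *\<^sub>v a)
    = design_energy \<gamma> \<beta> \<alpha> \<xi> \<xi> (vec_poly a) (vec_poly a)"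
proof -
  let ?R = "\<lambda>p. real_of_ereal (power_kernel \<gamma> \<beta> \<alpha> (fst p) (snd p))"
  let ?B = "B_mat m (poly_regressors m) (power_kernel \<gamma> \<beta> \<alpha>) \<xi>"
  have cont: "continuous_on UNIV (\<lambda>u::real. u ^ k)" for k by (intro continuous_intros)
  note int = design_energy_split(1)[OF \<xi> \<xi> fin cont cont]
  have "design_energy \<gamma> \<beta> \<alpha> \<xi> \<xi> (vec_poly a) (vec_poly a)
      = (LINT p|(\<xi> \<Otimes>\<^sub>M \<xi>). (\<Sum>i<m. \<Sum>j<m. a $ i * a $ j * (?R p * (fst p ^ i * snd p ^ j))))"
    unfolding design_energy_def
  proof (rule Bochner_Integration.integral_cong[OF refl])
    fix p :: "real \<times> real"
    have "vec_poly a (fst p) * vec_poly a (snd p) = (\<Sum>i<m. \<Sum>j<m. a $ i * fst p ^ i * (a $ j * snd p ^ j))"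
      using a by (simp add: vec_poly_def sum_product)
    then show "?R p * (vec_poly a (fst p) * vec_poly a (snd p))
        = (\<Sum>i<m. \<Sum>j<m. a $ i * a $ j * (?R p * (fst p ^ i * snd p ^ j)))"
      by (simp add: sum_distrib_left mult_ac)
  qed
  also have "\<dots> = (\<Sum>i<m. \<Sum>j<m. a $ i * a $ j * design_energy \<gamma> \<beta> \<alpha> \<xi> \<xi> (\<lambda>u. u ^ i) (\<lambda>v. v ^ j))"
    unfolding design_energy_def using int
    by (simp only: Bochner_Integration.integral_sum Bochner_Integration.integrable_sum integrable_mult_right
        integral_mult_right_zero)
  also have "\<dots> = (\<Sum>i<m. \<Sum>j<m. a $ i * a $ j * ?B $$ (i, j))"
    by (intro sum.cong refl) (simp add: B_mat_entry)
  also have "\<dots> = scalar_prod a (?B *\<^sub>v a)"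
    using a by (simp add: scalar_prod_def B_mat_def atLeast0LessThan sum_distrib_left mult_ac)
  finally show ?thesis ..
qed

lemma power_kernel_commute: "power_kernel \<gamma> \<beta> \<alpha> u v = power_kernel \<gamma> \<beta> \<alpha> v u"
  by (auto simp: power_kernel_def abs_minus_commute)

lemma design_energy_commute:
  assumes \<xi>: "is_design \<xi>" and "continuous_on UNIV g" "continuous_on UNIV h"
  shows "design_energy \<gamma> \<beta> \<alpha> \<xi> \<xi> g h = design_energy \<gamma> \<beta> \<alpha> \<xi> \<xi> h g"
proof -
  interpret prob_space \<xi> by (rule is_designD[OF \<xi>])
  interpret pair_sigma_finite \<xi> \<xi> ..
  let ?f = "\<lambda>p. real_of_ereal (power_kernel \<gamma> \<beta> \<alpha> (fst p) (snd p)) * (g (fst p) * h (snd p))"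
  have "?f \<in> borel_measurable (\<xi> \<Otimes>\<^sub>M \<xi>)"
    using measurable_design_pair[OF \<xi> \<xi> borel_measurable_continuous_onI[OF assms(2)]]
      measurable_design_pair[OF \<xi> \<xi> borel_measurable_continuous_onI[OF assms(3)]]
    by (intro borel_measurable_times borel_measurable_real_of_ereal measurable_design_power_kernel \<xi>) auto
  from integral_product_swap[OF this]
  have "integral\<^sup>L (\<xi> \<Otimes>\<^sub>M \<xi>) ?f = (LINT p|(\<xi> \<Otimes>\<^sub>M \<xi>). ?f (snd p, fst p))"
    by (simp add: case_prod_unfold)
  also have "\<dots> = design_energy \<gamma> \<beta> \<alpha> \<xi> \<xi> h g"
    unfolding design_energy_def fst_conv snd_conv
    by (intro Bochner_Integration.integral_cong refl arg_cong2[of _ _ _ _ "(*)"]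
        arg_cong[of _ _ real_of_ereal] power_kernel_commute mult.commute)
  finally show ?thesis by (simp add: design_energy_def)
qed

lemma transpose_B_mat:
  assumes "is_design \<xi>"
  shows "transpose_mat (B_mat m (poly_regressors m) (power_kernel \<gamma> \<beta> \<alpha>) \<xi>)
    = B_mat m (poly_regressors m) (power_kernel \<gamma> \<beta> \<alpha>) \<xi>"
proof (rule eq_matI)
  fix i j
  assume "i < dim_row (B_mat m (poly_regressors m) (power_kernel \<gamma> \<beta> \<alpha>) \<xi>)"
    and "j < dim_col (B_mat m (poly_regressors m) (power_kernel \<gamma> \<beta> \<alpha>) \<xi>)"
  then have ij: "i < m" "j < m" by (auto simp: B_mat_def)
  then have "transpose_mat (B_mat m (poly_regressors m) (power_kernel \<gamma> \<beta> \<alpha>) \<xi>) $$ (i, j)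
      = B_mat m (poly_regressors m) (power_kernel \<gamma> \<beta> \<alpha>) \<xi> $$ (j, i)"
    by (simp add: B_mat_def)
  also have "\<dots> = B_mat m (poly_regressors m) (power_kernel \<gamma> \<beta> \<alpha>) \<xi> $$ (i, j)"
    unfolding B_mat_entry[OF ij] B_mat_entry[OF ij(2,1)]
    by (intro design_energy_commute assms continuous_intros)
  finally show "transpose_mat (B_mat m (poly_regressors m) (power_kernel \<gamma> \<beta> \<alpha>) \<xi>) $$ (i, j)
    = B_mat m (poly_regressors m) (power_kernel \<gamma> \<beta> \<alpha>) \<xi> $$ (i, j)" .
qed (simp_all add: B_mat_def)

lemma mat_inverse_symmetric:
  fixes A :: "real mat"
  assumes A: "A \<in> carrier_mat m m" and inv: "invertible_mat A" and sym: "transpose_mat A = A"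
  defines "N \<equiv> the (mat_inverse A)"
  shows "N \<in> carrier_mat m m" "A * N = 1\<^sub>m m" "transpose_mat N = N"
proof -
  obtain B where B: "A * B = 1\<^sub>m (dim_row A)" "B * A = 1\<^sub>m (dim_row B)"
    using inv by (auto simp: invertible_mat_def inverts_mat_def)
  \<comment> \<open>\<open>invertible_mat\<close> says nothing about the shape of the inverse; it is
    read off from the two identities.\<close>
  have "dim_col B = m" using A arg_cong[OF B(1), of dim_col] by simp
  moreover have "dim_row B = m" using A arg_cong[OF B(2), of dim_col] by simp
  ultimately have Bc: "B \<in> carrier_mat m m" by auto
  with A B have "A \<in> Units (ring_mat TYPE(real) m ())"
    by (auto simp: Units_def ring_mat_def)
  with mat_inverse(1)[OF A, where b = "()"] have "mat_inverse A = Some N"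
    unfolding N_def by (cases "mat_inverse A") auto
  from mat_inverse(2)[OF A this] have N: "A * N = 1\<^sub>m m" "N * A = 1\<^sub>m m" "N \<in> carrier_mat m m" by auto
  then show "A * N = 1\<^sub>m m" "N \<in> carrier_mat m m" by auto
  have "transpose_mat N = transpose_mat N * (A * N)" using N by simp
  also have "\<dots> = transpose_mat (A * N) * N"
    using A N sym by (subst transpose_mult[OF A N(3)]) (auto intro!: assoc_mult_mat[symmetric])
  also have "\<dots> = N" using N by simp
  finally show "transpose_mat N = N" .
qed

text \<open>The vector \<open>a\<close> is the inverse information matrix applied to
  \<open>x\<close>. Because that inverse is symmetric, both of its copies in D can be moved onto
  \<open>x\<close>.\<close>

lemma D_mat_quadratic_form:
  fixes x :: "real vec" and \<beta> \<gamma> :: real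
  assumes \<xi>: "diffuse_design \<alpha> \<xi>" and fin: "finite_energy \<alpha> \<xi> \<xi>"
    and inv: "invertible_mat (M_mat m (poly_regressors m) \<xi>)"
  defines "D \<equiv> D_mat m (poly_regressors m) (power_kernel \<gamma> \<beta> \<alpha>) \<xi>"
  shows "D \<in> carrier_mat m m" and "transpose_mat D = D"
    and "x \<in> carrier_vec m \<Longrightarrow> \<exists>a\<in>carrier_vec m. (\<forall>j<m. (LINT u|\<xi>. vec_poly a u * u ^ j) = x $ j)
      \<and> scalar_prod x (D *\<^sub>v x) = design_energy \<gamma> \<beta> \<alpha> \<xi> \<xi> (vec_poly a) (vec_poly a)"
proof -
  let ?M = "M_mat m (poly_regressors m) \<xi>" and ?B = "B_mat m (poly_regressors m) (power_kernel \<gamma> \<beta> \<alpha>) \<xi>"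
  define N where "N = the (mat_inverse ?M)"
  have d: "is_design \<xi>" using \<xi> by (simp add: diffuse_design_def)
  note N = mat_inverse_symmetric[OF M_mat_carrier inv transpose_M_mat, folded N_def]
  have B: "?B \<in> carrier_mat m m" and Bt: "transpose_mat ?B = ?B"
    using transpose_B_mat[OF d] by auto
  have D: "D = N * ?B * N" by (simp add: D_def D_mat_def N_def)
  show "D \<in> carrier_mat m m" unfolding D using N(1) B by auto
  show "transpose_mat D = D"
  proof -
    have "transpose_mat D = N * (?B * N)"
      unfolding D using N B Bt by (simp add: transpose_mult[of _ m m _ m])
    also have "\<dots> = D" unfolding D using N B by (intro assoc_mult_mat[symmetric]) auto
    finally show ?thesis .
  qed
  assume x: "x \<in> carrier_vec m"
  define a where "a = N *\<^sub>v x"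
  have a: "a \<in> carrier_vec m" unfolding a_def using N(1) x by simp
  have "?M *\<^sub>v a = (?M * N) *\<^sub>v x"
    unfolding a_def by (rule assoc_mult_mat_vec[OF M_mat_carrier N(1) x, symmetric])
  also have "\<dots> = x" using N(2) x by simp
  finally have "?M *\<^sub>v a = x" .
  then have "\<forall>j<m. (LINT u|\<xi>. vec_poly a u * u ^ j) = x $ j"
    using M_mat_mult_vec[OF d a] by auto
  moreover have "scalar_prod x (D *\<^sub>v x) = design_energy \<gamma> \<beta> \<alpha> \<xi> \<xi> (vec_poly a) (vec_poly a)"
  proof -
    have "D *\<^sub>v x = N *\<^sub>v (?B *\<^sub>v a)"
      unfolding D a_def using N(1) B x by (simp add: assoc_mult_mat_vec[of _ m m _ m])
    then have "scalar_prod x (D *\<^sub>v x) = scalar_prod (transpose_mat N *\<^sub>v x) (?B *\<^sub>v a)"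
      using transpose_vec_mult_scalar[OF N(1) _ x, of "?B *\<^sub>v a"] B a by simp
    also have "\<dots> = scalar_prod a (?B *\<^sub>v a)" by (simp add: N(3) a_def)
    finally show ?thesis using B_mat_quadratic_form[OF \<xi> fin a] by simp
  qed
  ultimately show "\<exists>a\<in>carrier_vec m. (\<forall>j<m. (LINT u|\<xi>. vec_poly a u * u ^ j) = x $ j)
      \<and> scalar_prod x (D *\<^sub>v x) = design_energy \<gamma> \<beta> \<alpha> \<xi> \<xi> (vec_poly a) (vec_poly a)"
    using a by blast
qed

text \<open>For a vector v in the kernel, the scalar product of v with M v is the integral of the
  square of its polynomial, so that polynomial vanishes almost everywhere. A nonzero polynomial has
  finitely many roots, and finite sets are null for the arcsine design.\<close>

lemma invertible_M_mat_arcsine: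
  assumes \<alpha>: "0 \<le> \<alpha>" "\<alpha> < 1"
  shows "invertible_mat (M_mat m (poly_regressors m) (arcsine_design \<alpha>))"
proof -
  let ?\<xi> = "arcsine_design \<alpha>"
  let ?M = "M_mat m (poly_regressors m) ?\<xi>"
  note d = is_design_arcsine[OF \<alpha>]
  interpret prob_space ?\<xi> by (rule is_designD[OF d])
  have "v = 0\<^sub>v m" if v: "v \<in> carrier_vec m" and Mv: "?M *\<^sub>v v = 0\<^sub>v m" for v
  proof (rule ccontr)
    assume "v \<noteq> 0\<^sub>v m"
    then obtain i where i: "i < m" "v $ i \<noteq> 0" using v by (auto simp: vec_eq_iff)
    have cont: "continuous_on UNIV (\<lambda>u. vec_poly v u * vec_poly v u)"
      by (intro continuous_intros continuous_on_vec_poly)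
    have "(LINT u|?\<xi>. vec_poly v u * vec_poly v u) = (LINT u|?\<xi>. (\<Sum>j<m. v $ j * (vec_poly v u * u ^ j)))"
      using v by (subst (2) vec_poly_def) (simp add: sum_distrib_left mult_ac)
    also have "\<dots> = (\<Sum>j<m. v $ j * (LINT u|?\<xi>. vec_poly v u * u ^ j))"
      by (subst Bochner_Integration.integral_sum)
         (auto intro!: integrable_mult_right continuous_on_design(3)[OF _ d] continuous_intros continuous_on_vec_poly)
    also have "\<dots> = 0"
      using M_mat_mult_vec[OF d v] Mv by simp
    finally have "AE u in ?\<xi>. vec_poly v u * vec_poly v u = 0"
      using integral_nonneg_eq_0_iff_AE[OF continuous_on_design(3)[OF cont d]] by simp
    then have AE0: "AE u in ?\<xi>. (\<Sum>j\<le>m - 1. v $ j * u ^ j) = 0"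
    proof eventually_elim
      case (elim u)
      \<comment> \<open>The root bound concerns sums up to an inclusive index; \<open>m - 1\<close>
        is no truncation, since \<open>i < m\<close> gives \<open>0 < m\<close>.\<close>
      have "{..<m} = {..m - 1}" using i by auto
      with elim v show ?case by (simp add: vec_poly_def)
    qed
    define Z where "Z = {u::real. (\<Sum>j\<le>m - 1. v $ j * u ^ j) = 0}"
    have "finite Z" unfolding Z_def polyfun_finite_roots
      using i by (intro exI[of _ i]) auto
    have "AE u in ?\<xi>. \<forall>z\<in>Z. u \<noteq> z"
      unfolding AE_finite_all[OF \<open>finite Z\<close>]
    proof
      fix z
      show "AE u in ?\<xi>. u \<noteq> z"
      proof (cases "z \<in> {-1..1}")
        case True
        then have "{z} \<in> null_sets ?\<xi>"
          using emeasure_arcsine_singleton[OF True] d by (auto simp: is_design_def sets_restrict_space_iff)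
        from AE_not_in[OF this] show ?thesis by simp
      next
        case False
        then show ?thesis using is_designD(2)[OF d] by (intro AE_I2) auto
      qed
    qed
    with AE0 have "AE u in ?\<xi>. False"
      by eventually_elim (auto simp: Z_def)
    then show False by simp
  qed
  then have "Determinant.det ?M \<noteq> 0"
    using det_0_iff_vec_prod_zero_field[OF M_mat_carrier] by blast
  from det_non_zero_imp_unit[OF M_mat_carrier this, where b = "()"]
  have "mat_inverse ?M \<noteq> None"
    using mat_inverse(1)[OF M_mat_carrier, where b = "()"] by blast
  then obtain N where "mat_inverse ?M = Some N" by blast
  from mat_inverse(2)[OF M_mat_carrier this] show ?thesis
    by (auto simp: invertible_mat_def inverts_mat_def square_mat.simps M_mat_def)
qed

theorem theorem4p6:
  fixes m :: nat and \<alpha> \<beta> \<gamma> :: real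
  assumes "1 \<le> m"
    and "0 \<le> \<alpha>" and "\<alpha> < 1"
    and "0 \<le> \<gamma>"
    and "0 < \<beta>"
  shows "universally_optimal m (poly_regressors m) (power_kernel \<gamma> \<beta> \<alpha>) (arcsine_design \<alpha>)"
  unfolding universally_optimal_def
proof (intro conjI ballI)
  let ?f = "poly_regressors m" and ?K = "power_kernel \<gamma> \<beta> \<alpha>" and ?\<nu> = "arcsine_design \<alpha>"
  note \<alpha> = \<open>0 \<le> \<alpha>\<close> \<open>\<alpha> < 1\<close>
  note \<nu> = diffuse_design_arcsine[OF \<alpha>] finite_energy_arcsine[OF \<alpha> diffuse_design_arcsine[OF \<alpha>]]
    invertible_M_mat_arcsine[OF \<alpha>, of m]
  show "?\<nu> \<in> admissible_designs m ?f ?K"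
    using \<nu> is_design_arcsine[OF \<alpha>] B_well_defined_finite_energy by (simp add: admissible_designs_def)
  fix \<xi> assume adm: "\<xi> \<in> admissible_designs m ?f ?K"
  then have \<xi>: "diffuse_design \<alpha> \<xi>" "finite_energy \<alpha> \<xi> \<xi>" "invertible_mat (M_mat m ?f \<xi>)"
    using admissible_finite_energy[of m \<gamma> \<beta> \<xi> \<alpha>] assms by (auto simp: admissible_designs_def)
  let ?D = "D_mat m ?f ?K \<xi>" and ?D' = "D_mat m ?f ?K ?\<nu>"
  note D = D_mat_quadratic_form[OF \<xi>, where \<gamma> = \<gamma> and \<beta> = \<beta>] and D' = D_mat_quadratic_form[OF \<nu>, where \<gamma> = \<gamma> and \<beta> = \<beta>]
  have "0 \<le> scalar_prod x ((?D - ?D') *\<^sub>v x)" if x: "x \<in> carrier_vec m" for x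
  proof -
    obtain a where a: "a \<in> carrier_vec m" "\<And>j. j < m \<Longrightarrow> (LINT u|\<xi>. vec_poly a u * u ^ j) = x $ j"
      "scalar_prod x (?D *\<^sub>v x) = design_energy \<gamma> \<beta> \<alpha> \<xi> \<xi> (vec_poly a) (vec_poly a)"
      using D(3)[OF x] by blast
    obtain b where b: "b \<in> carrier_vec m" "\<And>j. j < m \<Longrightarrow> (LINT u|?\<nu>. vec_poly b u * u ^ j) = x $ j"
      "scalar_prod x (?D' *\<^sub>v x) = design_energy \<gamma> \<beta> \<alpha> ?\<nu> ?\<nu> (vec_poly b) (vec_poly b)"
      using D'(3)[OF x] by blast
    have vb: "vec_poly b = (\<lambda>u. \<Sum>i<m. b $ i * u ^ i)" using b(1) by (simp add: vec_poly_def fun_eq_iff)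
    \<comment> \<open>One \<open>c\<close> for both designs: as \<open>a\<close> and
      \<open>b\<close> produce the same moments \<open>x $ j\<close>, the two energies below get the
      same value.\<close>
    obtain c where c: "\<And>\<mu> g. diffuse_design \<alpha> \<mu> \<Longrightarrow> continuous_on UNIV g \<Longrightarrow>
        design_energy \<gamma> \<beta> \<alpha> \<mu> ?\<nu> g (vec_poly b) = (\<Sum>j<m. c j * (LINT u|\<mu>. g u * u ^ j))"
      using design_energy_arcsine[OF \<alpha> \<open>1 \<le> m\<close>, of \<gamma> \<beta> "\<lambda>i. b $ i", folded vb] by blast
    have "design_energy \<gamma> \<beta> \<alpha> \<xi> ?\<nu> (vec_poly a) (vec_poly b) = (\<Sum>j<m. c j * x $ j)"
      using c[OF \<xi>(1) continuous_on_vec_poly] a(2) by simp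
    moreover have "design_energy \<gamma> \<beta> \<alpha> ?\<nu> ?\<nu> (vec_poly b) (vec_poly b) = (\<Sum>j<m. c j * x $ j)"
      using c[OF \<nu>(1) continuous_on_vec_poly] b(2) by simp
    \<comment> \<open>The middle term is minus twice the last one, so what remains is the difference
      of the two quadratic forms.\<close>
    moreover have "0 \<le> design_energy \<gamma> \<beta> \<alpha> \<xi> \<xi> (vec_poly a) (vec_poly a)
        - 2 * design_energy \<gamma> \<beta> \<alpha> \<xi> ?\<nu> (vec_poly a) (vec_poly b)
        + design_energy \<gamma> \<beta> \<alpha> ?\<nu> ?\<nu> (vec_poly b) (vec_poly b)"
      using assms \<xi> \<nu> by (intro design_energy_nonneg finite_energy_arcsine continuous_on_vec_poly) auto
    ultimately have "scalar_prod x (?D' *\<^sub>v x) \<le> scalar_prod x (?D *\<^sub>v x)"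
      unfolding a(3) b(3) by simp
    then show ?thesis
      unfolding minus_mult_distrib_mat_vec[OF D(1) D'(1) x]
        scalar_prod_minus_distrib[OF x mult_mat_vec_carrier[OF D(1) x] mult_mat_vec_carrier[OF D'(1) x]]
      by simp
  qed
  then show "loewner_le m ?D' ?D"
    using D(1,2) D'(1,2) by (auto simp: loewner_le_def pos_semidef_def transpose_minus[of _ m m])
qed

end
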